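(* Let $k$ be an algebraically closed field of characteristic $2$. If the indices $i_1,\dots,i_s,j_1,\dots,j_s\in\{1,\dots,m\}$ are all different, then the $O(4)$-invariant $G^{(i_1,\dots,i_s|j_1,\dots,j_s)}\in R_{4\times m}^{O(4)}$ is not expressible as a polynomial in $O(4)$-invariants of degree less than $2s-2$.
   Context: $k$ is an algebraically closed field of characteristic $2$. $O(4)$ is the group of linear automorphisms of $k^4$ (coordinates $x_1,x_2,y_1,y_2$) preserving the quadratic form $q=x_1y_1+x_2y_2$; $SO(4)$ is the connected component of the identity in the algebraic group $O(4)$ (a subgroup of index $2$). $R_{4\times m}$ is the algebra of polynomials over $k$ in the coordinates $x_1^{(i)},x_2^{(i)},y_1^{(i)},y_2^{(i)}$ of $m$ indeterminate vectors $v^{(1)},\dots,v^{(m)}$ in $k^4$, with $O(4)$ acting diagonally; a superscript group denotes the subalgebra of invariants. Degree means total degree. To $v^{(i)}$ associate the $2\times2$ matrix $V^{(i)}=\begin{pmatrix} x_1^{(i)} & x_2^{(i)}\\ y_2^{(i)} & y_1^{(i)}\end{pmatrix}$. For pairwise different indices $i_1,\dots,i_s,j_1,\dots,j_s$, consider the determinant of the $2s\times 2s$ matrix made of $s\times s$ blocks of size $2\times 2$, $$\left|\begin{matrix} V^{(i_1)} & V^{(j_1)} & & & \\ & V^{(i_2)} & V^{(j_2)} & & \\ & & \ddots & \ddots & \\ & & & V^{(i_{s-1})} & V^{(j_{s-1})}\\ V^{(j_s)} & & & & V^{(i_s)}\end{matrix}\right|,$$ that is, block row $t$ has $V^{(i_t)}$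 in block column $t$ and $V^{(j_t)}$ in block column $t+1$ (block columns read cyclically modulo $s$), and zeros elsewhere. $F=F^{(i_1,\dots,i_s|j_1,\dots,j_s)}$ denotes its $2s$-linear component, i.e. its multi-homogeneous component of degree $1$ in each of the $2s$ vectors $v^{(i_1)},\dots,v^{(i_s)},v^{(j_1)},\dots,v^{(j_s)}$; it is $SO(4)$-invariant. Define $$G^{(i_1,\dots,i_s|j_1,\dots,j_s)}=F+\sigma F,$$ where $\sigma$ is any representative of the coset $O(4)\setminus SO(4)$ (the polynomial $\sigma F$ does not depend on the choice); $G$ is $O(4)$-invariant. *)

theory Defs
  imports
    "HOL-Library.Poly_Mapping"
    "HOL-Analysis.Abstract_Topology_2"
    "HOL-Analysis.Finite_Cartesian_Product"
    "Jordan_Normal_Form.Determinant"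
begin

no_notation vec_index (infixl "$" 100)

section \<open>Polynomials\<close>

text \<open>
  Polynomials over \<open>'k\<close> in the variables \<open>'v\<close>: the monoid algebra of the monomials
  \<open>'v \<Rightarrow>\<^sub>0 nat\<close>, so that \<open>lookup p u\<close> is the coefficient of the monomial \<open>u\<close> in \<open>p\<close>.
\<close>

type_synonym ('v, 'k) mpoly = "('v \<Rightarrow>\<^sub>0 nat) \<Rightarrow>\<^sub>0 'k"

definition Const :: "'k::comm_semiring_1 \<Rightarrow> ('v, 'k) mpoly" where
  "Const c = Poly_Mapping.single 0 c"

definition Var :: "'v \<Rightarrow> ('v, 'k::comm_semiring_1) mpoly" where
  "Var x = Poly_Mapping.single (Poly_Mapping.single x 1) 1"

definition poly_vars :: "('v, 'k::zero) mpoly \<Rightarrow> 'v set" where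
  "poly_vars p = (\<Union>u\<in>Poly_Mapping.keys p. Poly_Mapping.keys u)"

definition monom_degree :: "('v \<Rightarrow>\<^sub>0 nat) \<Rightarrow> nat" where
  "monom_degree u = (\<Sum>x\<in>Poly_Mapping.keys u. Poly_Mapping.lookup u x)"

text \<open>The zero polynomial gets degree \<open>0\<close>.\<close>

definition total_degree :: "('v, 'k::zero) mpoly \<Rightarrow> nat" where
  "total_degree p = Max (insert 0 (monom_degree ` Poly_Mapping.keys p))"

definition monom_value :: "('v \<Rightarrow> 'b::comm_semiring_1) \<Rightarrow> ('v \<Rightarrow>\<^sub>0 nat) \<Rightarrow> 'b" where
  "monom_value f u = (\<Prod>x\<in>Poly_Mapping.keys u. f x ^ Poly_Mapping.lookup u x)"

text \<open>The map sending each variable \<open>x\<close> to \<open>f x\<close> and each coefficient \<open>c\<close> to \<open>h c\<close>.\<close>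

definition insertion ::
    "('k \<Rightarrow> 'b) \<Rightarrow> ('v \<Rightarrow> 'b) \<Rightarrow> ('v, 'k::zero) mpoly \<Rightarrow> 'b::comm_semiring_1" where
  "insertion h f p = (\<Sum>u\<in>Poly_Mapping.keys p. h (Poly_Mapping.lookup p u) * monom_value f u)"

abbreviation eval_poly :: "('v \<Rightarrow> 'k) \<Rightarrow> ('v, 'k) mpoly \<Rightarrow> 'k::comm_semiring_1" where
  "eval_poly \<equiv> insertion (\<lambda>c. c)"

abbreviation subst_poly ::
    "('v \<Rightarrow> ('w, 'k) mpoly) \<Rightarrow> ('v, 'k) mpoly \<Rightarrow> ('w, 'k::comm_semiring_1) mpoly" where
  "subst_poly \<equiv> insertion Const"

definition expressible_in ::
    "('v, 'k) mpoly set \<Rightarrow> ('v, 'k::comm_semiring_1) mpoly \<Rightarrow> bool" where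
  "expressible_in S p \<longleftrightarrow>
     (\<exists>(P :: (nat, 'k) mpoly) f. (\<forall>n\<in>poly_vars P. f n \<in> S) \<and> p = subst_poly f P)"


section \<open>The groups \<open>O(4)\<close> and \<open>SO(4)\<close>\<close>

datatype coord = X1 | X2 | Y1 | Y2

lemma UNIV_coord: "UNIV = {X1, X2, Y1, Y2}"
  by (auto intro: coord.exhaust)

instance coord :: finite
  by standard (simp add: UNIV_coord)

definition quad_form :: "'k::comm_ring_1 ^ coord \<Rightarrow> 'k" where
  "quad_form v = v $ X1 * v $ Y1 + v $ X2 * v $ Y2"

definition O4 :: "('k::field ^ coord ^ coord) set" where
  "O4 = {g. invertible g \<and> (\<forall>v. quad_form (g *v v) = quad_form v)}"

text \<open>The Zariski topology on the affine space of \<open>4 \<times> 4\<close> matrices: the closed sets are the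
  zero loci of sets of polynomials in the matrix entries.\<close>

definition zero_locus :: "(coord \<times> coord, 'k) mpoly set \<Rightarrow> ('k::field ^ coord ^ coord) set" where
  "zero_locus P = {A. \<forall>p\<in>P. eval_poly (\<lambda>(a, b). A $ a $ b) p = 0}"

definition zariski :: "('k::field ^ coord ^ coord) topology" where
  "zariski = topology (\<lambda>U. \<exists>P. U = - zero_locus P)"

definition SO4 :: "('k::field ^ coord ^ coord) set" where
  "SO4 = connected_component_of_set (subtopology zariski O4) (Finite_Cartesian_Product.mat 1)"


subsection \<open>The Zariski topology is a topology\<close>

lemma monom_value_superset:
  assumes "finite K" "Poly_Mapping.keys u \<subseteq> K"
  shows "monom_value f u = (\<Prod>x\<in>K. f x ^ Poly_Mapping.lookup u x)"
  unfolding monom_value_def using assms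
  by (intro prod.mono_neutral_left) (auto simp: in_keys_iff)

lemma monom_value_add: "monom_value f (u + w) = monom_value f u * monom_value f w"
proof -
  let ?K = "Poly_Mapping.keys u \<union> Poly_Mapping.keys w"
  have "Poly_Mapping.keys (u + w) \<subseteq> ?K"
    by (rule keys_add)
  then show ?thesis
    by (simp add: monom_value_superset[where K = ?K] lookup_add power_add prod.distrib)
qed

lemma eval_poly_superset:
  fixes p :: "('v, 'k::comm_semiring_1) mpoly"
  assumes "finite K" "Poly_Mapping.keys p \<subseteq> K"
  shows "eval_poly f p = (\<Sum>u\<in>K. Poly_Mapping.lookup p u * monom_value f u)"
  unfolding insertion_def using assms
  by (intro sum.mono_neutral_left) (auto simp: in_keys_iff)

lemma eval_poly_add:
  fixes p q :: "('v, 'k::comm_semiring_1) mpoly"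
  shows "eval_poly f (p + q) = eval_poly f p + eval_poly f q"
proof -
  let ?K = "Poly_Mapping.keys p \<union> Poly_Mapping.keys q"
  have "Poly_Mapping.keys (p + q) \<subseteq> ?K"
    by (rule keys_add)
  then show ?thesis
    by (simp add: eval_poly_superset[where K = ?K] lookup_add distrib_right sum.distrib)
qed

lemma eval_poly_single:
  "eval_poly f (Poly_Mapping.single u (c :: 'k::comm_semiring_1)) = c * monom_value f u"
  by (simp add: insertion_def)

lemma eval_poly_sum:
  fixes p :: "'i \<Rightarrow> ('v, 'k::comm_semiring_1) mpoly"
  shows "eval_poly f (sum p I) = (\<Sum>i\<in>I. eval_poly f (p i))"
  by (induction I rule: infinite_finite_induct) (auto simp: eval_poly_add insertion_def[of _ _ 0])

lemma mpoly_as_sum: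
  fixes p :: "('v, 'k::comm_semiring_1) mpoly"
  shows "p = (\<Sum>u\<in>Poly_Mapping.keys p. Poly_Mapping.single u (Poly_Mapping.lookup p u))"
  by (rule poly_mapping_eqI) (auto simp: lookup_sum lookup_single when_def in_keys_iff)

lemma eval_poly_mult:
  fixes p q :: "('v, 'k::comm_semiring_1) mpoly"
  shows "eval_poly f (p * q) = eval_poly f p * eval_poly f q"
proof -
  have "p * q =
      (\<Sum>u\<in>Poly_Mapping.keys p. Poly_Mapping.single u (Poly_Mapping.lookup p u)) *
      (\<Sum>w\<in>Poly_Mapping.keys q. Poly_Mapping.single w (Poly_Mapping.lookup q w))"
    by (rule arg_cong2[where f = "(*)"]) (rule mpoly_as_sum)+
  also have "\<dots> = (\<Sum>u\<in>Poly_Mapping.keys p. \<Sum>w\<in>Poly_Mapping.keys q.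
      Poly_Mapping.single (u + w) (Poly_Mapping.lookup p u * Poly_Mapping.lookup q w))"
    by (simp only: sum_product mult_single)
  finally have "eval_poly f (p * q) = (\<Sum>u\<in>Poly_Mapping.keys p. \<Sum>w\<in>Poly_Mapping.keys q.
      (Poly_Mapping.lookup p u * Poly_Mapping.lookup q w) * (monom_value f u * monom_value f w))"
    by (simp only: eval_poly_sum eval_poly_single monom_value_add)
  also have "\<dots> = eval_poly f p * eval_poly f q"
    unfolding insertion_def sum_product by (intro sum.cong refl) (simp only: mult_ac)
  finally show ?thesis .
qed

lemma zero_locus_Un: "zero_locus P \<union> zero_locus Q = zero_locus {p * q | p q. p \<in> P \<and> q \<in> Q}"
proof (intro equalityI subsetI)
  fix A assume "A \<in> zero_locus P \<union> zero_locus Q"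
  then show "A \<in> zero_locus {p * q | p q. p \<in> P \<and> q \<in> Q}"
    by (auto simp: zero_locus_def eval_poly_mult)
next
  fix A assume A: "A \<in> zero_locus {p * q | p q. p \<in> P \<and> q \<in> Q}"
  let ?e = "eval_poly (\<lambda>(a, b). A $ a $ b)"
  have "?e p = 0 \<or> ?e q = 0" if "p \<in> P" "q \<in> Q" for p q
  proof -
    have "?e (p * q) = 0"
      using A that unfolding zero_locus_def by blast
    then show ?thesis
      by (simp add: eval_poly_mult)
  qed
  then show "A \<in> zero_locus P \<union> zero_locus Q"
    unfolding zero_locus_def by blast
qed

lemma zero_locus_UN: "zero_locus (\<Union>i\<in>I. P i) = (\<Inter>i\<in>I. zero_locus (P i))"
  unfolding zero_locus_def by blast

lemma istopology_zariski: "istopology (\<lambda>U. \<exists>P. U = - zero_locus P)"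
  unfolding istopology_def
proof (intro conjI allI impI)
  fix S T :: "('a ^ coord ^ coord) set"
  assume "\<exists>P. S = - zero_locus P" "\<exists>P. T = - zero_locus P"
  then obtain P Q where "S = - zero_locus P" "T = - zero_locus Q"
    by (elim exE)
  then have "S \<inter> T = - zero_locus {p * q | p q. p \<in> P \<and> q \<in> Q}"
    by (simp only: zero_locus_Un[symmetric] Compl_Un)
  then show "\<exists>P. S \<inter> T = - zero_locus P" ..
next
  fix \<K> :: "('a ^ coord ^ coord) set set"
  assume "\<forall>K\<in>\<K>. \<exists>P. K = - zero_locus P"
  from bchoice[OF this] obtain P where P: "\<forall>K\<in>\<K>. K = - zero_locus (P K)" ..
  have "\<Union>\<K> = (\<Union>K\<in>\<K>. - zero_locus (P K))"
    using P by (intro arg_cong[where f = Union]) (auto simp only: image_iff)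
  also have "\<dots> = - zero_locus (\<Union>K\<in>\<K>. P K)"
    by (simp only: zero_locus_UN Compl_INT)
  finally show "\<exists>P. \<Union>\<K> = - zero_locus P" ..
qed

lemma openin_zariski: "openin zariski U \<longleftrightarrow> (\<exists>P. U = - zero_locus P)"
  unfolding zariski_def by (simp only: topology_inverse'[OF istopology_zariski])

lemma topspace_zariski: "topspace zariski = UNIV"
proof -
  have "UNIV = - zero_locus {1}"
    by (simp add: zero_locus_def insertion_def monom_value_def)
  then have "openin zariski UNIV"
    unfolding openin_zariski ..
  from openin_subset[OF this] show ?thesis
    by (rule top_le)
qed

lemma closedin_zariski: "closedin zariski Z \<longleftrightarrow> (\<exists>P. Z = zero_locus P)"
proof -
  have "closedin zariski Z \<longleftrightarrow> (\<exists>P. - Z = - zero_locus P)"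
    by (simp only: closedin_def topspace_zariski openin_zariski subset_UNIV simp_thms
        Compl_eq_Diff_UNIV[symmetric])
  then show ?thesis
    by (simp only: compl_eq_compl_iff)
qed


section \<open>Vector invariants\<close>

text \<open>The variable \<open>(c, i)\<close> is the coordinate \<open>c\<close> of the \<open>i\<close>-th indeterminate vector.\<close>

definition R4 :: "nat \<Rightarrow> (coord \<times> nat, 'k::field) mpoly set" where
  "R4 m = {p. poly_vars p \<subseteq> UNIV \<times> {1..m}}"

text \<open>The action \<open>(g f)(v) = f (g\<^sup>-\<^sup>1 v)\<close>, where \<open>g\<close> acts diagonally on tuples of vectors.\<close>

definition act ::
    "'k::field ^ coord ^ coord \<Rightarrow> (coord \<times> nat, 'k) mpoly \<Rightarrow> (coord \<times> nat, 'k) mpoly" where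
  "act g = subst_poly (\<lambda>(c, i). \<Sum>d\<in>UNIV. Const (matrix_inv g $ c $ d) * Var (d, i))"

definition O4_invariants :: "nat \<Rightarrow> (coord \<times> nat, 'k::field) mpoly set" where
  "O4_invariants m = {p \<in> R4 m. \<forall>g\<in>O4. act g p = p}"

definition multidegree :: "(coord \<times> nat \<Rightarrow>\<^sub>0 nat) \<Rightarrow> nat \<Rightarrow> nat" where
  "multidegree u i = (\<Sum>c\<in>UNIV. Poly_Mapping.lookup u (c, i))"

definition multihom_component ::
    "(nat \<Rightarrow> nat) \<Rightarrow> (coord \<times> nat, 'k::field) mpoly \<Rightarrow> (coord \<times> nat, 'k) mpoly" where
  "multihom_component \<alpha> p =
     (\<Sum>u\<in>{u \<in> Poly_Mapping.keys p. multidegree u = \<alpha>}.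
        Poly_Mapping.single u (Poly_Mapping.lookup p u))"

definition vmat :: "nat \<Rightarrow> (coord \<times> nat, 'k::field) mpoly Matrix.mat" where
  "vmat i = mat_of_rows_list 2
     [[Var (X1, i), Var (X2, i)],
      [Var (Y2, i), Var (Y1, i)]]"

text \<open>The indices \<open>i\<^sub>1, \<dots>, i\<^sub>s\<close> and \<open>j\<^sub>1, \<dots>, j\<^sub>s\<close> are given as lists. Rows, columns and blocks are
  counted from \<open>0\<close>; entry \<open>(r, c)\<close> lies in block \<open>(r div 2, c div 2)\<close>.\<close>

definition block_matrix ::
    "nat list \<Rightarrow> nat list \<Rightarrow> (coord \<times> nat, 'k::field) mpoly Matrix.mat" where
  "block_matrix il jl =
     (let s = length il in
      Matrix.mat (2 * s) (2 * s) (\<lambda>(r, c).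
        if c div 2 = r div 2 then vmat (il ! (r div 2)) $$ (r mod 2, c mod 2)
        else if c div 2 = (r div 2 + 1) mod s then vmat (jl ! (r div 2)) $$ (r mod 2, c mod 2)
        else 0))"

definition F_poly :: "nat list \<Rightarrow> nat list \<Rightarrow> (coord \<times> nat, 'k::field) mpoly" where
  "F_poly il jl =
     multihom_component (\<lambda>i. if i \<in> set (il @ jl) then 1 else 0)
       (Determinant.det (block_matrix il jl))"

definition G_poly ::
    "'k::field ^ coord ^ coord \<Rightarrow> nat list \<Rightarrow> nat list \<Rightarrow> (coord \<times> nat, 'k) mpoly" where
  "G_poly \<sigma> il jl = F_poly il jl + act \<sigma> (F_poly il jl)"

end

theory Submission
  imports Defs "HOL-Library.Product_Lexorder"
begin

text \<open>
  A vector is identified with its \<open>2 \<times> 2\<close> matrix \<open>V\<close>. In characteristic \<open>2\<close> the quadratic form is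
  then \<open>det V\<close>, and everything can be phrased with \<open>2 \<times> 2\<close> matrices over a commutative ring.

  The invariants become traces. Block elimination gives
  \<open>det M = \<Prod>det A\<^sub>t + \<Prod>det B\<^sub>t + tr (\<Prod>adj A\<^sub>t B\<^sub>t)\<close> for the cyclic block matrix \<open>M\<close> with blocks
  \<open>A\<^sub>t\<close>, \<open>B\<^sub>t\<close> (\<open>det_cyclic_blocks\<close>). The first two terms have degree \<open>2\<close> in some vectors, so
  \<open>F\<close> is the trace \<open>T = tr (\<Prod>adj V(i\<^sub>t) V(j\<^sub>t))\<close> (\<open>F_poly_eq_cyclic_trace\<close>).
  Every element of \<open>O(4)\<close> is \<open>V \<mapsto> P V Q\<close> or \<open>V \<mapsto> P adj(V) Q\<close> with \<open>det P = det Q = 1\<close>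
  (\<open>O4_cases\<close>). The maps of the first kind fix \<open>T\<close> and \<open>T' = tr (\<Prod>V(i\<^sub>t) adj V(j\<^sub>t))\<close>, those of the
  second kind exchange them (\<open>act_trace_inv\<close>). As \<open>SL\<^sub>2\<close> is generated by elementary matrices, which
  lie on affine lines, every map of the first kind lies in the identity component
  (\<open>lr_mult_in_SO4\<close>); so \<open>\<sigma>\<close> is of the second kind and \<open>G = T + T'\<close> is invariant.

  For the indecomposability, specialise \<open>v(i\<^sub>1)\<close> to the matrix unit \<open>E\<^sub>1\<^sub>2\<close>, \<open>v(j\<^sub>1)\<close> to
  \<open>E\<^sub>2\<^sub>1\<close>, one further vector \<open>v(r)\<close>, \<open>r = i\<^sub>2\<close>, to \<open>t\<^sub>r E\<^sub>1\<^sub>1\<close>, and the remaining vectors with index in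
  \<open>N = {i\<^sub>2, \<dots>, i\<^sub>s, j\<^sub>2, \<dots>, j\<^sub>s}\<close> to the scalar matrices \<open>t\<^sub>i I\<close>, the \<open>t\<^sub>i\<close> being new variables. Then
  \<open>G\<close> becomes \<open>\<plusminus>\<Prod>t\<^sub>i\<close> over \<open>i \<in> N\<close>, a monomial of degree \<open>2s - 2\<close>. On the other hand, the reflection exchanging
  the coordinates \<open>x\<^sub>1\<close> and \<open>y\<^sub>1\<close> fixes \<open>E\<^sub>1\<^sub>2\<close> and \<open>E\<^sub>2\<^sub>1\<close>, and \<open>t\<^sub>i I\<close> is the sum of \<open>t\<^sub>i E\<^sub>1\<^sub>1\<close> and its
  mirror image. So in the specialisation of an invariant the monomials without \<open>t\<^sub>r\<close> arise from pairs of
  mirror monomials with equal coefficients, which cancel in characteristic \<open>2\<close>, and from monomials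
  that are their own mirror image, which yield squares (\<open>even_poly_subst_swap_invariant\<close>). Hence a squarefree
  monomial \<open>u \<noteq> 1\<close> in the specialisation of an invariant of degree less than \<open>2s - 2\<close> is divisible by
  \<open>t\<^sub>r\<close> but not by all \<open>t\<^sub>i\<close>. This property passes to sums and products (\<open>obstruction_add\<close>): of two
  factors of a squarefree monomial only one contains \<open>t\<^sub>r\<close>, so the other one must be \<open>1\<close>. Since
  \<open>\<Prod>t\<^sub>i\<close> violates it, \<open>G\<close> is not a polynomial in such invariants.
\<close>

section \<open>The ring of \<open>2 \<times> 2\<close> matrices\<close>

datatype 'a mat2 = Mat2 'a 'a 'a 'a

instantiation mat2 :: (comm_ring_1) ring_1
begin

fun plus_mat2 :: "'a mat2 \<Rightarrow> 'a mat2 \<Rightarrow> 'a mat2" where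
  "Mat2 a b c d + Mat2 a' b' c' d' = Mat2 (a + a') (b + b') (c + c') (d + d')"

fun minus_mat2 :: "'a mat2 \<Rightarrow> 'a mat2 \<Rightarrow> 'a mat2" where
  "Mat2 a b c d - Mat2 a' b' c' d' = Mat2 (a - a') (b - b') (c - c') (d - d')"

fun uminus_mat2 :: "'a mat2 \<Rightarrow> 'a mat2" where
  "- Mat2 a b c d = Mat2 (- a) (- b) (- c) (- d)"

fun times_mat2 :: "'a mat2 \<Rightarrow> 'a mat2 \<Rightarrow> 'a mat2" where
  "Mat2 a b c d * Mat2 a' b' c' d' =
     Mat2 (a * a' + b * c') (a * b' + b * d') (c * a' + d * c') (c * b' + d * d')"

definition "0 = Mat2 0 0 0 0"

definition "1 = Mat2 1 0 0 1"

instance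
proof
  fix x y z :: "'a mat2"
  show "x + y + z = x + (y + z)"
    by (cases x; cases y; cases z) simp
  show "x + y = y + x"
    by (cases x; cases y) simp
  show "0 + x = x" "- x + x = 0"
    by (cases x; simp add: zero_mat2_def)+
  show "x - y = x + - y"
    by (cases x; cases y) simp
  show "x * y * z = x * (y * z)"
    by (cases x; cases y; cases z) (simp add: algebra_simps)
  show "(x + y) * z = x * z + y * z" "z * (x + y) = z * x + z * y"
    by (cases x; cases y; cases z; simp add: algebra_simps)+
  show "1 * x = x" "x * 1 = x"
    by (cases x; simp add: one_mat2_def)+
  show "(0 :: 'a mat2) \<noteq> 1"
    by (simp add: zero_mat2_def one_mat2_def)
qed

end

fun det2 :: "'a::comm_ring_1 mat2 \<Rightarrow> 'a" where
  "det2 (Mat2 a b c d) = a * d - b * c"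

fun tr2 :: "'a::comm_ring_1 mat2 \<Rightarrow> 'a" where
  "tr2 (Mat2 a b c d) = a + d"

fun adj2 :: "'a::comm_ring_1 mat2 \<Rightarrow> 'a mat2" where
  "adj2 (Mat2 a b c d) = Mat2 d (- b) (- c) a"

definition scal2 :: "'a::comm_ring_1 \<Rightarrow> 'a mat2" where
  "scal2 c = Mat2 c 0 0 c"

lemma det2_mult: "det2 (x * y) = det2 x * det2 y"
  by (cases x; cases y) (simp add: algebra_simps)

lemma det2_1 [simp]: "det2 1 = 1"
  by (simp add: one_mat2_def)

lemma det2_scal2 [simp]: "det2 (scal2 c) = c * c"
  by (simp add: scal2_def)

lemma det2_adj2 [simp]: "det2 (adj2 x) = det2 x"
  by (cases x) (simp add: algebra_simps)

lemma det2_prod_list: "det2 (prod_list xs) = prod_list (map det2 xs)"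
  by (induction xs) (simp_all add: det2_mult)

lemma adj2_mult: "adj2 (x * y) = adj2 y * adj2 x"
  by (cases x; cases y) (simp add: algebra_simps)

lemma adj2_adj2 [simp]: "adj2 (adj2 x) = x"
  by (cases x) simp

lemma mult_adj2: "x * adj2 x = scal2 (det2 x)" "adj2 x * x = scal2 (det2 x)"
  by (cases x; simp add: scal2_def algebra_simps)+

lemma tr2_mult_commute: "tr2 (x * y) = tr2 (y * x)"
  by (cases x; cases y) (simp add: algebra_simps)

lemma tr2_scal2_mult: "tr2 (scal2 c * x) = c * tr2 x"
  by (cases x) (simp add: scal2_def algebra_simps)

lemma scal2_commute: "x * scal2 c = scal2 c * x"
  by (cases x) (simp add: scal2_def algebra_simps)

lemma scal2_left_commute: "x * (scal2 c * y) = scal2 c * (x * y)"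
  by (simp only: scal2_commute flip: mult.assoc)

lemma scal2_mult: "scal2 (c * d) = scal2 c * scal2 d"
  by (simp add: scal2_def)

lemma scal2_1 [simp]: "scal2 1 = 1"
  by (simp add: scal2_def one_mat2_def)

lemma adj2_scal2 [simp]: "adj2 (scal2 c) = scal2 c"
  by (simp add: scal2_def)

text \<open>
  The middle term is the polar form of the determinant. A linear map preserving \<open>det2\<close> therefore
  preserves it as well.
\<close>

lemma det2_add: "det2 (x + y) = det2 x + tr2 (adj2 y * x) + det2 y"
  by (cases x; cases y) (simp add: algebra_simps)

lemma double_mat2: "(\<And>a :: 'a. a + a = 0) \<Longrightarrow> x + x = (0 :: 'a::comm_ring_1 mat2)"
  by (cases x) (simp add: zero_mat2_def)

section \<open>Determinants of cyclic block matrices\<close>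

fun mat2_nth :: "'a mat2 \<Rightarrow> nat \<Rightarrow> nat \<Rightarrow> 'a" where
  "mat2_nth (Mat2 a b c d) i j =
     (if i = 0 then if j = 0 then a else b else if j = 0 then c else d)"

lemma mat2_nth_0 [simp]: "mat2_nth 0 i j = 0"
  by (simp add: zero_mat2_def)

lemma mat2_nth_add: "mat2_nth (x + y) i j = mat2_nth x i j + mat2_nth y i j"
  by (cases x; cases y) simp

lemma mat2_nth_sum: "mat2_nth (sum f I) i j = (\<Sum>k\<in>I. mat2_nth (f k) i j)"
  by (induction I rule: infinite_finite_induct) (simp_all add: mat2_nth_add)

lemma mat2_nth_mult: "mat2_nth (x * y) i j = mat2_nth x i 0 * mat2_nth y 0 j + mat2_nth x i 1 * mat2_nth y 1 j"
  by (cases x; cases y) simp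

definition blocks :: "nat \<Rightarrow> (nat \<Rightarrow> nat \<Rightarrow> 'a mat2) \<Rightarrow> 'a Matrix.mat" where
  "blocks n f = Matrix.mat (2 * n) (2 * n)
     (\<lambda>(r, c). mat2_nth (f (r div 2) (c div 2)) (r mod 2) (c mod 2))"

lemma blocks_carrier [simp]: "blocks n f \<in> carrier_mat (2 * n) (2 * n)"
  by (simp add: blocks_def)

lemma blocks_cong: "(\<And>i j. i < n \<Longrightarrow> j < n \<Longrightarrow> f i j = g i j) \<Longrightarrow> blocks n f = blocks n g"
  unfolding blocks_def by (intro eq_matI) auto

lemma sum_pairs: "(\<Sum>l<2 * n. h l) = (\<Sum>k<n. h (2 * k) + h (2 * k + 1))"
  for h :: "nat \<Rightarrow> 'a::comm_monoid_add"
  by (induction n) (simp_all add: add.assoc)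

lemma blocks_mult: "blocks n f * blocks n g = blocks n (\<lambda>i j. \<Sum>k<n. f i k * g k j)"
proof (rule eq_matI)
  fix r c
  assume "r < dim_row (blocks n (\<lambda>i j. \<Sum>k<n. f i k * g k j))"
    and "c < dim_col (blocks n (\<lambda>i j. \<Sum>k<n. f i k * g k j))"
  then have rc: "r < 2 * n" "c < 2 * n"
    by (simp_all add: blocks_def)
  have "(blocks n f * blocks n g) $$ (r, c) =
      (\<Sum>l<2 * n. mat2_nth (f (r div 2) (l div 2)) (r mod 2) (l mod 2) *
        mat2_nth (g (l div 2) (c div 2)) (l mod 2) (c mod 2))"
    using rc by (simp add: blocks_def scalar_prod_def atLeast0LessThan)
  also have "\<dots> = blocks n (\<lambda>i j. \<Sum>k<n. f i k * g k j) $$ (r, c)"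
    using rc by (simp add: sum_pairs blocks_def mat2_nth_sum mat2_nth_mult)
  finally show "(blocks n f * blocks n g) $$ (r, c) =
      blocks n (\<lambda>i j. \<Sum>k<n. f i k * g k j) $$ (r, c)" .
qed (simp_all add: blocks_def)

lemma det_blocks_1: "Determinant.det (blocks 1 f) = det2 (f 0 0)"
proof (cases "f 0 0")
  case (Mat2 a b c d)
  let ?M = "blocks 1 f"
  have M: "?M \<in> carrier_mat 2 2"
    using blocks_carrier[of 1 f] by simp
  have minor: "Determinant.det (mat_delete ?M 0 j) = mat_delete ?M 0 j $$ (0, 0)" for j
    using M by (intro det_single) (simp add: mat_delete_def)
  have "Determinant.det ?M =
      ?M $$ (0, 0) * cofactor ?M 0 0 + ?M $$ (0, 1) * cofactor ?M 0 1"
    using laplace_expansion_row[OF M, of 0] by (simp add: numeral_2_eq_2)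
  then have "Determinant.det ?M = ?M $$ (0, 0) * ?M $$ (1, 1) - ?M $$ (0, 1) * ?M $$ (1, 0)"
    unfolding cofactor_def minor using M by (simp add: mat_delete_def)
  then show ?thesis
    by (simp add: blocks_def Mat2)
qed

lemma blocks_Suc: "blocks (Suc n) f = four_block_mat (blocks n f)
    (Matrix.mat (2 * n) 2 (\<lambda>(r, c). mat2_nth (f (r div 2) n) (r mod 2) c))
    (Matrix.mat 2 (2 * n) (\<lambda>(r, c). mat2_nth (f n (c div 2)) r (c mod 2)))
    (blocks 1 (\<lambda>i j. f n n))"
proof -
  have *: "x div 2 = n" "x mod 2 = x - 2 * n" "(x - 2 * n) div 2 = 0" "x - 2 * n < 2"
    if "\<not> x < 2 * n" "x < 2 * Suc n" for x
    using that by presburger+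
  show ?thesis
    by (rule eq_matI) (auto simp: blocks_def *)
qed

lemma det_blocks_Suc_lower:
  fixes f :: "nat \<Rightarrow> nat \<Rightarrow> 'a::idom mat2"
  assumes "\<And>i. i < n \<Longrightarrow> f i n = 0"
  shows "Determinant.det (blocks (Suc n) f) = Determinant.det (blocks n f) * det2 (f n n)"
proof -
  have "Matrix.mat (2 * n) 2 (\<lambda>(r, c). mat2_nth (f (r div 2) n) (r mod 2) c) = 0\<^sub>m (2 * n) 2"
    using assms by (intro eq_matI) auto
  then show ?thesis
    unfolding blocks_Suc
    by (subst det_four_block_mat_upper_right_zero[where n = "2 * n" and m = 2])
      (auto simp: det_blocks_1[simplified] blocks_carrier[of 1, simplified])
qed

lemma det_blocks_Suc_upper:
  fixes f :: "nat \<Rightarrow> nat \<Rightarrow> 'a::idom mat2"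
  assumes "\<And>j. j < n \<Longrightarrow> f n j = 0"
  shows "Determinant.det (blocks (Suc n) f) = Determinant.det (blocks n f) * det2 (f n n)"
proof -
  have "Matrix.mat 2 (2 * n) (\<lambda>(r, c). mat2_nth (f n (c div 2)) r (c mod 2)) = 0\<^sub>m 2 (2 * n)"
    using assms by (intro eq_matI) auto
  then show ?thesis
    unfolding blocks_Suc
    by (subst det_four_block_mat_lower_left_zero[where n = "2 * n" and m = 2])
      (auto simp: det_blocks_1[simplified] blocks_carrier[of 1, simplified])
qed

lemma det_blocks_upper:
  fixes f :: "nat \<Rightarrow> nat \<Rightarrow> 'a::idom mat2"
  assumes "\<And>i j. j < i \<Longrightarrow> i < n \<Longrightarrow> f i j = 0"
  shows "Determinant.det (blocks n f) = (\<Prod>i<n. det2 (f i i))"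
  using assms
proof (induction n)
  case 0
  show ?case
    by (simp add: blocks_def)
next
  case (Suc n)
  then show ?case
    by (simp add: det_blocks_Suc_upper)
qed

text \<open>
  Replace the last block column of \<open>M\<close> by a combination of all block columns, with coefficients
  \<open>Q\<^sub>t\<close> solving \<open>A\<^sub>t Q\<^sub>t + B\<^sub>t Q\<^sub>t\<^sub>+\<^sub>1 = 0\<close> for \<open>t < n\<close>, so that only its last block survives. Taking
  \<open>Q\<^sub>n = e\<close>, the product of the determinants of \<open>A\<^sub>0, \<dots>, A\<^sub>n\<^sub>-\<^sub>1\<close>, avoids division: \<open>Q\<^sub>t\<close> is then the
  product of \<open>det A\<^sub>0, \<dots>, det A\<^sub>t\<^sub>-\<^sub>1\<close> and of \<open>adj A\<^sub>u B\<^sub>u\<close> for \<open>t \<le> u < n\<close>. The resulting matrix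
  is block triangular; comparing determinants gives the identity multiplied by \<open>e\<^sup>2\<close>.
\<close>

lemma det_cyclic_blocks:
  fixes A B :: "nat \<Rightarrow> 'a::idom mat2"
  assumes char2: "\<And>a :: 'a. a + a = 0" and "n \<ge> 1" and A: "\<And>t. t < n \<Longrightarrow> det2 (A t) \<noteq> 0"
  shows "Determinant.det (blocks (Suc n)
        (\<lambda>i j. if j = i then A i else if j = (i + 1) mod Suc n then B i else 0)) =
      (\<Prod>t<Suc n. det2 (A t)) + (\<Prod>t<Suc n. det2 (B t)) +
      tr2 (prod_list (map (\<lambda>t. adj2 (A t) * B t) [0..<Suc n]))"
proof -
  define f where "f = (\<lambda>i j. if j = i then A i else if j = (i + 1) mod Suc n then B i else 0)"
  define e where "e t = (\<Prod>u<t. det2 (A u))" for t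
  define C where "C t = prod_list (map (\<lambda>t. adj2 (A t) * B t) [t..<n])" for t
  define Q where "Q t = scal2 (e t) * C t" for t
  define u where "u = (\<lambda>i j. if j = n then Q i else if i = j then 1 else 0)"
  define w where "w = (\<lambda>i j. \<Sum>k<Suc n. f i k * u k j)"
  have C_n: "C n = 1"
    by (simp add: C_def)
  have C_step: "C t = adj2 (A t) * B t * C (Suc t)" if "t < n" for t
    using that by (simp add: C_def upt_conv_Cons)
  have w_col: "w i j = f i j" if "i < Suc n" "j < n" for i j
  proof -
    have "w i j = (\<Sum>k<Suc n. if k = j then f i j else 0)"
      unfolding w_def using that by (intro sum.cong) (auto simp: u_def)
    then show ?thesis
      using that by simp
  qed
  have w_last: "w i n = A i * Q i + B i * Q ((i + 1) mod Suc n)" if i: "i < Suc n" for i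
  proof -
    have ne: "(i + 1) mod Suc n \<noteq> i"
      using i \<open>n \<ge> 1\<close> by (cases "i = n") auto
    have "w i n = (\<Sum>k<Suc n. f i k * Q k)"
      by (simp add: w_def u_def)
    also have "\<dots> = (\<Sum>k\<in>{i, (i + 1) mod Suc n}. f i k * Q k)"
      using i by (intro sum.mono_neutral_right) (auto simp: f_def)
    finally show ?thesis
      using ne by (simp add: f_def)
  qed
  (* Characteristic 2: the two summands of w_last coincide. *)
  have w_zero: "w i n = 0" if i: "i < n" for i
  proof -
    have "A i * Q i = scal2 (e i) * (A i * adj2 (A i)) * B i * C (Suc i)"
      by (simp add: Q_def C_step[OF i] scal2_commute mult.assoc flip: scal2_commute[of "A i"])
        (metis mult.assoc scal2_commute)
    also have "\<dots> = B i * Q (Suc i)"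
      by (simp add: mult_adj2 Q_def e_def mult.assoc flip: scal2_mult)
        (metis mult.assoc scal2_commute)
    finally show ?thesis
      using i by (simp add: w_last double_mat2[OF char2])
  qed
  have e_nz: "e n \<noteq> 0"
    unfolding e_def using A by simp
  have det_u: "Determinant.det (blocks (Suc n) u) = e n * e n"
  proof -
    have "Determinant.det (blocks (Suc n) u) = (\<Prod>i<Suc n. det2 (u i i))"
      by (rule det_blocks_upper) (auto simp: u_def)
    also have "\<dots> = e n * e n"
      by (simp add: u_def Q_def C_n)
    finally show ?thesis .
  qed
  have "det2 (w n n) = e n * ((\<Prod>t<Suc n. det2 (A t)) + (\<Prod>t<Suc n. det2 (B t)) +
      tr2 (C 0 * (adj2 (A n) * B n)))"
  proof -
    have w_nn: "w n n = B n * C 0 + scal2 (e n) * A n"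
      by (simp add: w_last Q_def e_def C_n scal2_commute add.commute)
    have "det2 (C 0) = (\<Prod>t<n. det2 (A t) * det2 (B t))"
      by (simp add: C_def det2_prod_list comp_def det2_mult prod.list_conv_set_nth
          atLeast0LessThan)
    then have "det2 (C 0) = e n * (\<Prod>t<n. det2 (B t))"
      by (simp add: prod.distrib e_def)
    moreover have "adj2 (scal2 (e n) * A n) * (B n * C 0) =
        scal2 (e n) * ((adj2 (A n) * B n) * C 0)"
      by (simp add: adj2_mult) (metis mult.assoc scal2_commute)
    then have "tr2 (adj2 (scal2 (e n) * A n) * (B n * C 0)) =
        e n * tr2 (C 0 * (adj2 (A n) * B n))"
      by (metis tr2_scal2_mult tr2_mult_commute)
    ultimately show ?thesis
      unfolding w_nn det2_add by (simp add: det2_mult algebra_simps e_def)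
  qed
  moreover have "Determinant.det (blocks (Suc n) w) = e n * det2 (w n n)"
  proof -
    have "blocks n w = blocks n f"
      by (rule blocks_cong) (simp add: w_col)
    moreover have "Determinant.det (blocks n f) = e n"
      unfolding e_def by (subst det_blocks_upper) (auto simp: f_def)
    ultimately show ?thesis
      by (simp add: det_blocks_Suc_lower w_zero)
  qed
  moreover have "Determinant.det (blocks (Suc n) w) =
      Determinant.det (blocks (Suc n) f) * (e n * e n)"
    unfolding w_def blocks_mult[symmetric]
    by (subst det_mult[OF blocks_carrier blocks_carrier]) (simp add: det_u)
  ultimately have "Determinant.det (blocks (Suc n) f) * (e n * e n) =
      ((\<Prod>t<Suc n. det2 (A t)) + (\<Prod>t<Suc n. det2 (B t)) +
        tr2 (C 0 * (adj2 (A n) * B n))) * (e n * e n)"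
    by (simp add: mult_ac)
  moreover have "C 0 * (adj2 (A n) * B n) = prod_list (map (\<lambda>t. adj2 (A t) * B t) [0..<Suc n])"
    by (simp add: C_def)
  ultimately show ?thesis
    using e_nz unfolding f_def by simp
qed

section \<open>Substitution into polynomials\<close>

lemma Const_0 [simp]: "Const 0 = 0"
  by (simp add: Const_def)

lemma Const_1 [simp]: "Const 1 = 1"
  by (simp add: Const_def)

lemma Const_add: "Const (a + b) = Const a + Const b"
  by (simp add: Const_def single_add)

lemma Const_mult: "Const (a * b) = Const a * Const b"
  by (simp add: Const_def mult_single)

lemma Const_uminus: "Const (- a) = - Const (a :: 'k::comm_ring_1)"
  using Const_add[of "- a" a] by (simp add: eq_neg_iff_add_eq_0)

lemma subst_poly_superset:
  fixes p :: "('v, 'k::comm_semiring_1) mpoly"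
  assumes "finite K" "Poly_Mapping.keys p \<subseteq> K"
  shows "subst_poly f p = (\<Sum>u\<in>K. Const (Poly_Mapping.lookup p u) * monom_value f u)"
  unfolding insertion_def using assms
  by (intro sum.mono_neutral_left) (auto simp: in_keys_iff)

lemma subst_poly_add:
  fixes p q :: "('v, 'k::comm_semiring_1) mpoly"
  shows "subst_poly f (p + q) = subst_poly f p + subst_poly f q"
proof -
  let ?K = "Poly_Mapping.keys p \<union> Poly_Mapping.keys q"
  have "Poly_Mapping.keys (p + q) \<subseteq> ?K"
    by (rule keys_add)
  then show ?thesis
    by (simp add: subst_poly_superset[where K = ?K] lookup_add Const_add distrib_right sum.distrib)
qed

lemma subst_poly_0 [simp]: "subst_poly f 0 = 0"
  by (simp add: insertion_def)

lemma subst_poly_single: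
  "subst_poly f (Poly_Mapping.single u (c :: 'k::comm_semiring_1)) = Const c * monom_value f u"
  by (simp add: insertion_def)

lemma monom_value_0 [simp]: "monom_value f 0 = 1"
  by (simp add: monom_value_def)

lemma subst_poly_Const [simp]: "subst_poly f (Const c) = Const (c :: 'k::comm_semiring_1)"
  using subst_poly_single[of f 0 c] by (simp add: Const_def)

lemma subst_poly_Var [simp]: "subst_poly f (Var x) = f x"
  unfolding Var_def by (simp add: subst_poly_single monom_value_def)

lemma subst_poly_sum:
  fixes p :: "'i \<Rightarrow> ('v, 'k::comm_semiring_1) mpoly"
  shows "subst_poly f (sum p I) = (\<Sum>i\<in>I. subst_poly f (p i))"
  by (induction I rule: infinite_finite_induct) (auto simp: subst_poly_add)

lemma subst_poly_mult:
  fixes p q :: "('v, 'k::comm_semiring_1) mpoly"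
  shows "subst_poly f (p * q) = subst_poly f p * subst_poly f q"
proof -
  have "p * q =
      (\<Sum>u\<in>Poly_Mapping.keys p. Poly_Mapping.single u (Poly_Mapping.lookup p u)) *
      (\<Sum>w\<in>Poly_Mapping.keys q. Poly_Mapping.single w (Poly_Mapping.lookup q w))"
    by (rule arg_cong2[where f = "(*)"]) (rule mpoly_as_sum)+
  also have "\<dots> = (\<Sum>u\<in>Poly_Mapping.keys p. \<Sum>w\<in>Poly_Mapping.keys q.
      Poly_Mapping.single (u + w) (Poly_Mapping.lookup p u * Poly_Mapping.lookup q w))"
    by (simp only: sum_product mult_single)
  finally have "subst_poly f (p * q) = (\<Sum>u\<in>Poly_Mapping.keys p. \<Sum>w\<in>Poly_Mapping.keys q.
      (Const (Poly_Mapping.lookup p u) * Const (Poly_Mapping.lookup q w)) *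
      (monom_value f u * monom_value f w))"
    by (simp only: subst_poly_sum subst_poly_single monom_value_add Const_mult)
  also have "\<dots> = subst_poly f p * subst_poly f q"
    unfolding insertion_def sum_product by (intro sum.cong refl) (simp only: mult_ac)
  finally show ?thesis .
qed

lemma subst_poly_subst_poly:
  fixes p :: "('u, 'k::comm_semiring_1) mpoly"
  shows "subst_poly f (subst_poly g p) = subst_poly (\<lambda>x. subst_poly f (g x)) p"
proof -
  have one: "subst_poly f 1 = 1"
    using subst_poly_Const[of f 1] by (simp del: subst_poly_Const)
  have power: "subst_poly f (q ^ n) = subst_poly f q ^ n" for q n
    by (induction n) (simp_all add: one subst_poly_mult)
  have "subst_poly f (prod q K) = (\<Prod>x\<in>K. subst_poly f (q x))" for q and K :: "'u set"
    by (induction K rule: infinite_finite_induct) (simp_all add: one subst_poly_mult)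
  then have "subst_poly f (monom_value g v) = monom_value (\<lambda>x. subst_poly f (g x)) v" for v
    by (simp add: monom_value_def power)
  then show ?thesis
    unfolding insertion_def[of _ g] insertion_def[of _ "\<lambda>x. subst_poly f (g x)"]
    by (simp add: subst_poly_sum subst_poly_mult)
qed

lemma comm_ring_hom_subst_poly:
  "comm_ring_hom (subst_poly f :: ('v, 'k::comm_ring_1) mpoly \<Rightarrow> ('w, 'k) mpoly)"
  using subst_poly_Const[of f 1]
  by unfold_locales (simp_all add: subst_poly_add subst_poly_mult del: subst_poly_Const)

lemma comm_ring_hom_Const: "comm_ring_hom (Const :: 'k::comm_ring_1 \<Rightarrow> ('v, 'k) mpoly)"
  by unfold_locales (simp_all add: Const_add Const_mult)

context comm_ring_hom
begin

lemma map_mat2_mult: "map_mat2 hom (x * y) = map_mat2 hom x * map_mat2 hom y"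
  by (cases x; cases y) (simp add: hom_add hom_mult)

lemma map_mat2_1: "map_mat2 hom 1 = 1"
  by (simp add: one_mat2_def)

lemma map_mat2_adj2: "map_mat2 hom (adj2 x) = adj2 (map_mat2 hom x)"
  by (cases x) (simp add: hom_uminus)

lemma tr2_map_mat2: "tr2 (map_mat2 hom x) = hom (tr2 x)"
  by (cases x) (simp add: hom_add)

lemma det2_map_mat2: "det2 (map_mat2 hom x) = hom (det2 x)"
  by (cases x) (simp add: hom_mult hom_minus)

lemma map_mat2_prod_list: "map_mat2 hom (prod_list xs) = prod_list (map (map_mat2 hom) xs)"
  by (induction xs) (simp_all add: map_mat2_mult map_mat2_1)

end

section \<open>The multilinear component \<open>F\<close> as a trace\<close>

definition cyclic_trace :: "'a::comm_ring_1 mat2 list \<Rightarrow> 'a mat2 list \<Rightarrow> 'a" where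
  "cyclic_trace As Bs = tr2 (prod_list (map2 (\<lambda>a b. adj2 a * b) As Bs))"

lemma (in comm_ring_hom) hom_cyclic_trace:
  "hom (cyclic_trace As Bs) = cyclic_trace (map (map_mat2 hom) As) (map (map_mat2 hom) Bs)"
proof -
  have "map_mat2 hom \<circ> (\<lambda>(a, b). adj2 a * b) =
      (\<lambda>(a, b). adj2 a * b) \<circ> map_prod (map_mat2 hom) (map_mat2 hom)"
    by (auto simp: map_mat2_mult map_mat2_adj2)
  then show ?thesis
    by (simp add: cyclic_trace_def map_mat2_prod_list zip_map_map flip: tr2_map_mat2)
      (simp add: comp_def case_prod_beta)
qed

definition vec_mat2 :: "nat \<Rightarrow> (coord \<times> nat, 'k::comm_ring_1) mpoly mat2" where
  "vec_mat2 i = Mat2 (Var (X1, i)) (Var (X2, i)) (Var (Y2, i)) (Var (Y1, i))"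

lemma keys_Var [simp]:
  "Poly_Mapping.keys (Var x :: ('v, 'k::comm_semiring_1) mpoly) = {Poly_Mapping.single x 1}"
  by (simp add: Var_def)

lemma block_matrix_eq_blocks:
  "block_matrix il jl = blocks (length il) (\<lambda>i j. if j = i then vec_mat2 (il ! i)
     else if j = (i + 1) mod length il then vec_mat2 (jl ! i) else 0)"
proof -
  have "vmat i $$ (a mod 2, b mod 2) = mat2_nth (vec_mat2 i) (a mod 2) (b mod 2)" for i a b
    by (cases "even a"; cases "even b")
      (simp_all add: vmat_def vec_mat2_def mat_of_rows_list_def odd_iff_mod_2_eq_one)
  then show ?thesis
    by (auto simp: block_matrix_def blocks_def Let_def intro!: cong_mat)
qed

text \<open>
  Any linear order on the coordinates will do. Together with the lexicographic order on pairs it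
  turns the monomials into a linearly ordered monoid, and hence the polynomials into an integral
  domain, where the factor \<open>e\<^sup>2\<close> of \<open>det_cyclic_blocks\<close> can be cancelled.
\<close>

instantiation coord :: linorder
begin

fun coord_index :: "coord \<Rightarrow> nat" where
  "coord_index X1 = 0" | "coord_index X2 = 1" | "coord_index Y1 = 2" | "coord_index Y2 = 3"

definition "c \<le> d \<longleftrightarrow> coord_index c \<le> coord_index d"

definition "(c :: coord) < d \<longleftrightarrow> coord_index c < coord_index d"

instance
proof
  fix c d :: coord
  show "c \<le> d \<Longrightarrow> d \<le> c \<Longrightarrow> c = d"
    by (cases c; cases d) (simp_all add: less_eq_coord_def)
qed (auto simp: less_eq_coord_def less_coord_def)

end

lemma det2_vec_mat2_nonzero: "det2 (vec_mat2 i) \<noteq> (0 :: (coord \<times> nat, 'k::field) mpoly)"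
proof
  let ?s = "\<lambda>c. Poly_Mapping.single (c, i) (1::nat)"
  assume "det2 (vec_mat2 i) = (0 :: (coord \<times> nat, 'k) mpoly)"
  then have "Poly_Mapping.single (?s X1 + ?s Y1) (1 :: 'k) =
      Poly_Mapping.single (?s X2 + ?s Y2) 1"
    by (simp add: vec_mat2_def Var_def mult_single)
  then have "?s X1 + ?s Y1 = ?s X2 + ?s Y2"
    by (metis keys_single one_neq_zero singleton_inject)
  from arg_cong[OF this, of "\<lambda>u. Poly_Mapping.lookup u (X1, i)"] show False
    by (simp add: lookup_add lookup_single)
qed

lemma det_block_matrix:
  assumes char2: "(2 :: 'k::field) = 0" and "length il \<ge> 2" and len: "length jl = length il"
  shows "Determinant.det (block_matrix il jl :: (coord \<times> nat, 'k) mpoly Matrix.mat) =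
     prod_list (map (\<lambda>i. det2 (vec_mat2 i)) il) + prod_list (map (\<lambda>i. det2 (vec_mat2 i)) jl) +
     cyclic_trace (map vec_mat2 il) (map vec_mat2 jl)"
proof -
  have "x + x = 0" for x :: 'k
    using mult_2[of x] char2 by simp
  then have double: "a + a = 0" for a :: "(coord \<times> nat, 'k) mpoly"
    by (intro poly_mapping_eqI) (simp only: lookup_add lookup_zero)
  obtain n where n: "length il = Suc n" "n \<ge> 1"
    using \<open>length il \<ge> 2\<close> by (cases "length il") auto
  have "map2 (\<lambda>a b. adj2 a * b) (map vec_mat2 il) (map vec_mat2 jl) =
      map (\<lambda>t. adj2 (vec_mat2 (il ! t)) * vec_mat2 (jl ! t) :: (coord \<times> nat, 'k) mpoly mat2)
        [0..<Suc n]"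
    using len n by (intro nth_equalityI) (auto simp del: upt_Suc)
  moreover have "prod_list (map (\<lambda>i. det2 (vec_mat2 i)) l) =
      (\<Prod>t<Suc n. det2 (vec_mat2 (l ! t)) :: (coord \<times> nat, 'k) mpoly)"
    if "length l = Suc n" for l
    using that by (simp add: prod.list_conv_set_nth atLeast0LessThan)
  ultimately show ?thesis
    unfolding block_matrix_eq_blocks n(1) cyclic_trace_def
    using det_cyclic_blocks[OF double n(2), of "\<lambda>t. vec_mat2 (il ! t)" "\<lambda>t. vec_mat2 (jl ! t)"]
      len n by (simp add: det2_vec_mat2_nonzero del: upt_Suc prod.lessThan_Suc)
qed

definition multihomogeneous :: "(nat \<Rightarrow> nat) \<Rightarrow> (coord \<times> nat, 'k::zero) mpoly \<Rightarrow> bool" where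
  "multihomogeneous \<alpha> p \<longleftrightarrow> (\<forall>u\<in>Poly_Mapping.keys p. multidegree u = \<alpha>)"

lemma multidegree_add: "multidegree (u + w) i = multidegree u i + multidegree w i"
  by (simp add: multidegree_def lookup_add sum.distrib)

lemma multidegree_0: "multidegree 0 = (\<lambda>i. 0)"
  by (rule ext) (simp add: multidegree_def)

lemma multihomogeneous_1: "multihomogeneous (\<lambda>i. 0) 1"
  by (simp add: multihomogeneous_def multidegree_0)

lemma multihomogeneous_add:
  "multihomogeneous \<alpha> p \<Longrightarrow> multihomogeneous \<alpha> q \<Longrightarrow> multihomogeneous \<alpha> (p + q)"
  using keys_add[of p q] by (auto simp: multihomogeneous_def)

lemma multihomogeneous_diff:
  "multihomogeneous \<alpha> p \<Longrightarrow> multihomogeneous \<alpha> q \<Longrightarrow> multihomogeneous \<alpha> (p - q)"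
  for p :: "(coord \<times> nat, 'k::ab_group_add) mpoly"
  using keys_diff[of p q] by (auto simp: multihomogeneous_def)

lemma multihomogeneous_uminus:
  "multihomogeneous \<alpha> p \<Longrightarrow> multihomogeneous \<alpha> (- p)"
  for p :: "(coord \<times> nat, 'k::ab_group_add) mpoly"
  by (simp add: multihomogeneous_def)

lemma multihomogeneous_mult:
  assumes "multihomogeneous \<alpha> p" "multihomogeneous \<beta> q"
  shows "multihomogeneous (\<lambda>i. \<alpha> i + \<beta> i) (p * q)"
  unfolding multihomogeneous_def
proof
  fix u assume "u \<in> Poly_Mapping.keys (p * q)"
  with keys_mult[of p q] obtain v w
    where "u = v + w" "v \<in> Poly_Mapping.keys p" "w \<in> Poly_Mapping.keys q"
    by blast
  with assms show "multidegree u = (\<lambda>i. \<alpha> i + \<beta> i)"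
    by (auto simp: multihomogeneous_def multidegree_add)
qed

lemma multihomogeneous_Var: "multihomogeneous (\<lambda>j. if j = i then 1 else 0) (Var (c, i))"
proof -
  have "multidegree (Poly_Mapping.single (c, i) 1) = (\<lambda>j. if j = i then 1 else 0)"
    by (rule ext) (cases c; simp add: multidegree_def UNIV_coord lookup_single)
  then show ?thesis
    by (simp add: multihomogeneous_def)
qed

lemma lookup_multihom_component:
  "Poly_Mapping.lookup (multihom_component \<alpha> p) u =
     (if multidegree u = \<alpha> then Poly_Mapping.lookup p u else 0)"
  by (auto simp: multihom_component_def lookup_sum lookup_single when_def in_keys_iff)

lemma multihom_component_add:
  "multihom_component \<alpha> (p + q) = multihom_component \<alpha> p + multihom_component \<alpha> q"
  by (rule poly_mapping_eqI) (simp add: lookup_multihom_component lookup_add)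

lemma multihom_component_same: "multihomogeneous \<alpha> p \<Longrightarrow> multihom_component \<alpha> p = p"
  by (rule poly_mapping_eqI)
    (auto simp: lookup_multihom_component multihomogeneous_def in_keys_iff)

lemma multihom_component_other:
  "multihomogeneous \<beta> p \<Longrightarrow> \<beta> \<noteq> \<alpha> \<Longrightarrow> multihom_component \<alpha> p = 0"
  by (rule poly_mapping_eqI)
    (auto simp: lookup_multihom_component multihomogeneous_def in_keys_iff)

lemma multihomogeneous_det2s:
  "multihomogeneous (\<lambda>i. 2 * count_list l i) (prod_list (map (\<lambda>i. det2 (vec_mat2 i)) l)
      :: (coord \<times> nat, 'k::field) mpoly)"
proof (induction l)
  case Nil
  show ?case
    by (simp add: multihomogeneous_1)
next
  case (Cons a l)
  have "multihomogeneous (\<lambda>i. (if i = a then 1 else 0) + (if i = a then 1 else 0))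
      (det2 (vec_mat2 a) :: (coord \<times> nat, 'k) mpoly)"
    unfolding vec_mat2_def det2.simps
    by (intro multihomogeneous_diff multihomogeneous_mult multihomogeneous_Var)
  from multihomogeneous_mult[OF this Cons.IH] show ?case
    by (simp add: if_distrib cong: if_cong) (erule back_subst[of "\<lambda>\<alpha>. multihomogeneous \<alpha> _"], auto)
qed

lemma pred_mat2_mult:
  assumes "pred_mat2 (multihomogeneous \<alpha>) x" "pred_mat2 (multihomogeneous \<beta>) y"
  shows "pred_mat2 (multihomogeneous (\<lambda>i. \<alpha> i + \<beta> i)) (x * y)"
  using assms
  by (cases x; cases y) (auto intro!: multihomogeneous_add multihomogeneous_mult)

lemma multihomogeneous_cyclic_trace:
  assumes "length jl = length il"
  shows "multihomogeneous (count_list (il @ jl))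
    (cyclic_trace (map vec_mat2 il) (map vec_mat2 jl) :: (coord \<times> nat, 'k::field) mpoly)"
proof -
  have "pred_mat2 (multihomogeneous (\<lambda>i. count_list il i + count_list jl i))
      (prod_list (map2 (\<lambda>a b. adj2 a * b) (map vec_mat2 il) (map vec_mat2 jl))
        :: (coord \<times> nat, 'k) mpoly mat2)"
    using assms[symmetric]
  proof (induction il jl rule: list_induct2)
    case Nil
    show ?case
      by (simp add: one_mat2_def multihomogeneous_1) (simp add: multihomogeneous_def)
  next
    case (Cons a il b jl)
    have "pred_mat2 (multihomogeneous (\<lambda>j. if j = i then 1 else 0))
        (vec_mat2 i :: (coord \<times> nat, 'k) mpoly mat2)"
      "pred_mat2 (multihomogeneous (\<lambda>j. if j = i then 1 else 0))
        (adj2 (vec_mat2 i) :: (coord \<times> nat, 'k) mpoly mat2)" for i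
      unfolding vec_mat2_def adj2.simps mat2.pred_inject
      by (intro conjI multihomogeneous_uminus multihomogeneous_Var)+
    from pred_mat2_mult[OF pred_mat2_mult[OF this(2)[of a] this(1)[of b]] Cons.IH] show ?case
      by simp (erule back_subst[of "\<lambda>\<alpha>. pred_mat2 (multihomogeneous \<alpha>) _"], auto)
  qed
  then show ?thesis
    unfolding cyclic_trace_def
    by (cases "prod_list (map2 (\<lambda>a b. adj2 a * b) (map vec_mat2 il) (map vec_mat2 jl))
        :: (coord \<times> nat, 'k) mpoly mat2")
      (auto simp: count_list_append intro!: multihomogeneous_add
        elim!: back_subst[of "\<lambda>\<alpha>. multihomogeneous \<alpha> _"])
qed

text \<open>
  The two products of determinants in \<open>det_block_matrix\<close> have degree \<open>2\<close> in the vectors that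
  they involve, whereas the trace is linear in each of the \<open>2s\<close> different vectors.
\<close>

lemma F_poly_eq_cyclic_trace:
  assumes "(2 :: 'k::field) = 0" and "length il \<ge> 2" and len: "length jl = length il"
    and dist: "distinct (il @ jl)"
  shows "F_poly il jl =
    (cyclic_trace (map vec_mat2 il) (map vec_mat2 jl) :: (coord \<times> nat, 'k) mpoly)"
proof -
  let ?\<alpha> = "\<lambda>i. if i \<in> set (il @ jl) then 1 else 0 :: nat"
  have "count_list l i = (if i \<in> set l then 1 else 0)" if "distinct l" for l :: "nat list" and i
    using that by (induction l) auto
  from this[OF dist] have \<alpha>: "count_list (il @ jl) = ?\<alpha>"
    by auto
  have no: "multihom_component ?\<alpha> (prod_list (map (\<lambda>i. det2 (vec_mat2 i)) l)
      :: (coord \<times> nat, 'k) mpoly) = 0" if "l \<noteq> []" for l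
  proof (rule multihom_component_other[OF multihomogeneous_det2s])
    have "2 * count_list l (hd l) \<noteq> ?\<alpha> (hd l)"
      using that by (cases l) auto
    then show "(\<lambda>i. 2 * count_list l i) \<noteq> ?\<alpha>"
      by metis
  qed
  have "il \<noteq> []" "jl \<noteq> []"
    using assms by auto
  then show ?thesis
    unfolding F_poly_def det_block_matrix[OF assms(1-3)] multihom_component_add
    by (simp add: no[simplified] multihom_component_same[OF
          multihomogeneous_cyclic_trace[OF len, unfolded \<alpha>], simplified])
qed

section \<open>Orthogonal maps as left and right multiplications\<close>

fun coord_entry :: "coord \<Rightarrow> 'a mat2 \<Rightarrow> 'a" where
  "coord_entry X1 (Mat2 a b c d) = a" |
  "coord_entry X2 (Mat2 a b c d) = b" |
  "coord_entry Y2 (Mat2 a b c d) = c" |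
  "coord_entry Y1 (Mat2 a b c d) = d"

definition to_mat2 :: "'a ^ coord \<Rightarrow> 'a mat2" where
  "to_mat2 v = Mat2 (v $ X1) (v $ X2) (v $ Y2) (v $ Y1)"

definition of_mat2 :: "'a mat2 \<Rightarrow> 'a ^ coord" where
  "of_mat2 x = (\<chi> c. coord_entry c x)"

lemma to_mat2_of_mat2 [simp]: "to_mat2 (of_mat2 x) = x"
  by (cases x) (simp add: to_mat2_def of_mat2_def)

lemma of_mat2_to_mat2 [simp]: "of_mat2 (to_mat2 v) = v"
  unfolding Finite_Cartesian_Product.vec_eq_iff
proof
  show "of_mat2 (to_mat2 v) $ c = v $ c" for c
    by (cases c) (simp_all add: to_mat2_def of_mat2_def)
qed

lemma coord_entry_to_mat2 [simp]: "coord_entry c (to_mat2 v) = v $ c"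
  by (cases c) (simp_all add: to_mat2_def)

lemma to_mat2_inject: "to_mat2 v = to_mat2 w \<longleftrightarrow> v = w"
  by (metis of_mat2_to_mat2)

lemma to_mat2_add: "to_mat2 (v + w) = to_mat2 v + to_mat2 w"
  by (simp add: to_mat2_def)

lemma to_mat2_smult: "to_mat2 (c *s v) = scal2 c * to_mat2 v"
  by (simp add: to_mat2_def scal2_def)

lemma of_mat2_add: "of_mat2 (x + y) = of_mat2 x + of_mat2 y"
  by (simp add: to_mat2_add flip: to_mat2_inject)

lemma of_mat2_smult: "of_mat2 (scal2 c * x) = c *s of_mat2 x"
  by (simp add: to_mat2_smult flip: to_mat2_inject)

definition lr_mult :: "'a::comm_ring_1 mat2 \<Rightarrow> 'a mat2 \<Rightarrow> 'a ^ coord ^ coord" where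
  "lr_mult P Q = (\<chi> c d. coord_entry c (P * to_mat2 (axis d 1) * Q))"

lemma sum_coord: "(\<Sum>c\<in>UNIV. f c) = f X1 + f X2 + f Y1 + f Y2"
  for f :: "coord \<Rightarrow> 'a::comm_monoid_add"
  by (simp add: UNIV_coord add.assoc)

lemma to_mat2_axis:
  "to_mat2 (axis X1 1) = Mat2 1 0 0 0" "to_mat2 (axis X2 1) = Mat2 0 1 0 0"
  "to_mat2 (axis Y2 1) = Mat2 0 0 1 0" "to_mat2 (axis Y1 1) = Mat2 0 0 0 1"
  by (simp_all add: to_mat2_def axis_def)

lemma to_mat2_lr_mult: "to_mat2 (lr_mult P Q *v v) = P * to_mat2 v * Q"
  by (cases P; cases Q)
    (simp add: lr_mult_def matrix_vector_mult_def sum_coord to_mat2_axis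
      to_mat2_def[of v] to_mat2_def[of "vec_lambda _"] algebra_simps)

lemma matrix_eqI_to_mat2: "(\<And>v. to_mat2 (A *v v) = to_mat2 (B *v v)) \<Longrightarrow> A = B"
  for A B :: "'a::comm_ring_1 ^ coord ^ coord"
  by (simp add: to_mat2_inject matrix_eq)

lemma lr_mult_mult: "lr_mult P Q ** lr_mult P' Q' = lr_mult (P * P') (Q' * Q)"
  by (rule matrix_eqI_to_mat2)
    (simp add: to_mat2_lr_mult mult.assoc flip: matrix_vector_mul_assoc)

lemma lr_mult_1: "lr_mult 1 1 = Finite_Cartesian_Product.mat 1"
  by (rule matrix_eqI_to_mat2) (simp add: to_mat2_lr_mult)

lemma quad_form_eq_det2:
  assumes "(2 :: 'k::field) = 0"
  shows "quad_form v = det2 (to_mat2 (v :: 'k ^ coord))"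
proof -
  have "- x = x" for x :: 'k
    using mult_2[of x] assms by (simp add: neg_eq_iff_add_eq_0)
  from this[of "v $ X2 * v $ Y2"] show ?thesis
    by (simp add: quad_form_def to_mat2_def diff_conv_add_uminus del: add_uminus_conv_diff)
qed

lemma lr_mult_inverse:
  assumes "det2 P = 1" "det2 Q = 1"
  shows "lr_mult P Q ** lr_mult (adj2 P) (adj2 Q) = Finite_Cartesian_Product.mat 1"
  using assms by (simp add: lr_mult_mult mult_adj2 lr_mult_1)

lemma lr_mult_in_O4:
  assumes "(2 :: 'k::field) = 0" "det2 P = (1 :: 'k)" "det2 Q = 1"
  shows "lr_mult P Q \<in> O4"
proof -
  have "invertible (lr_mult P Q)"
    using lr_mult_inverse[of P Q] lr_mult_inverse[of "adj2 P" "adj2 Q"] assms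
    by (auto simp: invertible_def)
  then show ?thesis
    using assms by (simp add: O4_def quad_form_eq_det2 to_mat2_lr_mult det2_mult)
qed

section \<open>Left and right multiplications lie in \<open>SO(4)\<close>\<close>

lemma infinite_alg_closed: "infinite (UNIV :: 'k::alg_closed_field set)"
proof
  assume fin: "finite (UNIV :: 'k set)"
  (* Over a finite field this polynomial is nonconstant but has no root. *)
  define p :: "'k poly" where "p = (\<Prod>a\<in>UNIV. [:- a, 1:]) + 1"
  have p0: "poly p x = 1" for x
    using fin by (simp add: p_def poly_prod prod_zero_iff)
  have "degree (\<Prod>a\<in>(UNIV :: 'k set). [:- a, 1:]) = card (UNIV :: 'k set)"
    by (subst degree_prod_eq_sum_degree) auto
  moreover have "card (UNIV :: 'k set) > 0"
    using fin by (simp add: card_gt_0_iff)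
  ultimately have "degree p > 0"
    unfolding p_def by (subst degree_add_eq_left) auto
  then show False
    using alg_closed_imp_poly_has_root[of p] p0 by auto
qed

lemma eval_poly_on_line:
  fixes M N :: "'k::field ^ coord ^ coord"
  shows "\<exists>r. \<forall>t. eval_poly (\<lambda>(a, b). (\<chi> a b. M $ a $ b + t * N $ a $ b) $ a $ b) p = poly r t"
proof -
  let ?l = "\<lambda>(a, b). [:M $ a $ b, N $ a $ b:]"
  let ?r = "\<Sum>u\<in>Poly_Mapping.keys p. [:Poly_Mapping.lookup p u:] * (\<Prod>x\<in>Poly_Mapping.keys u. ?l x ^ Poly_Mapping.lookup u x)"
  have "eval_poly (\<lambda>(a, b). (\<chi> a b. M $ a $ b + t * N $ a $ b) $ a $ b) p = poly ?r t" for t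
    by (simp add: insertion_def monom_value_def poly_sum poly_prod case_prod_beta)
  then show ?thesis
    by blast
qed

text \<open>
  Polynomial functions restrict to polynomials in \<open>t\<close> on the line. A nonempty open subset of the line
  thus contains all points but finitely many, and two such subsets meet as the field is infinite.
\<close>

lemma connectedin_line:
  fixes M N :: "'k::alg_closed_field ^ coord ^ coord"
  assumes "\<And>t. (\<chi> a b. M $ a $ b + t * N $ a $ b) \<in> S"
  shows "connectedin (subtopology zariski S) (range (\<lambda>t. \<chi> a b. M $ a $ b + t * N $ a $ b))"
    (is "connectedin _ (range ?l)")
  unfolding connectedin_subtopology
proof
  show "range ?l \<subseteq> S"
    using assms by blast
  show "connectedin zariski (range ?l)"
    unfolding connectedin
  proof (intro conjI notI)
    show "range ?l \<subseteq> topspace zariski"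
      by (simp add: topspace_zariski)
    assume "\<exists>E1 E2. openin zariski E1 \<and> openin zariski E2 \<and> range ?l \<subseteq> E1 \<union> E2 \<and>
      E1 \<inter> E2 \<inter> range ?l = {} \<and> E1 \<inter> range ?l \<noteq> {} \<and> E2 \<inter> range ?l \<noteq> {}"
    then obtain E1 E2 where E: "openin zariski E1" "openin zariski E2"
        "E1 \<inter> E2 \<inter> range ?l = {}" "E1 \<inter> range ?l \<noteq> {}" "E2 \<inter> range ?l \<noteq> {}"
      by blast
    have mem: "A \<in> - zero_locus P \<longleftrightarrow> (\<exists>p\<in>P. eval_poly (\<lambda>(a, b). A $ a $ b) p \<noteq> 0)"
      for A :: "'k ^ coord ^ coord" and P
      by (simp add: zero_locus_def)
    have *: "\<exists>r. r \<noteq> 0 \<and> (\<forall>t. poly r t \<noteq> 0 \<longrightarrow> ?l t \<in> U)"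
      if U: "openin zariski U" "U \<inter> range ?l \<noteq> {}" for U
    proof -
      obtain P where P: "U = - zero_locus P"
        using U(1) by (auto simp: openin_zariski)
      from U(2) obtain t0 where "?l t0 \<in> U"
        by blast
      then obtain p where p: "p \<in> P" "eval_poly (\<lambda>(a, b). ?l t0 $ a $ b) p \<noteq> 0"
        unfolding P mem by blast
      obtain r where r: "\<And>t. eval_poly (\<lambda>(a, b). ?l t $ a $ b) p = poly r t"
        using eval_poly_on_line[of M N p] by blast
      have "r \<noteq> 0"
        using p(2) r[of t0] by (intro notI) simp
      moreover have "?l t \<in> U" if "poly r t \<noteq> 0" for t
        using that p(1) unfolding P mem r[symmetric] by blast
      ultimately show ?thesis
        by blast
    qed
    obtain r1 where r1: "r1 \<noteq> 0" "\<And>t. poly r1 t \<noteq> 0 \<Longrightarrow> ?l t \<in> E1"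
      using *[OF E(1,4)] by blast
    obtain r2 where r2: "r2 \<noteq> 0" "\<And>t. poly r2 t \<noteq> 0 \<Longrightarrow> ?l t \<in> E2"
      using *[OF E(2,5)] by blast
    have "finite {t. poly (r1 * r2) t = 0}"
      using r1(1) r2(1) by (intro poly_roots_finite) simp
    then obtain t where "poly (r1 * r2) t \<noteq> 0"
      using ex_new_if_finite[OF infinite_alg_closed] by blast
    then have "?l t \<in> E1 \<inter> E2"
      using r1(2) r2(2) by simp
    with E(3) show False
      by blast
  qed
qed

abbreviation joined :: "'k::field ^ coord ^ coord \<Rightarrow> 'k ^ coord ^ coord \<Rightarrow> bool" where
  "joined \<equiv> connected_component_of (subtopology zariski O4)"

lemma joined_line:
  fixes M N :: "'k::alg_closed_field ^ coord ^ coord"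
  assumes "\<And>t. (\<chi> a b. M $ a $ b + t * N $ a $ b) \<in> O4"
  shows "joined (\<chi> a b. M $ a $ b + t * N $ a $ b) M"
proof -
  let ?l = "\<lambda>t. \<chi> a b. M $ a $ b + t * N $ a $ b"
  have "?l 0 = M"
    by (simp add: Finite_Cartesian_Product.vec_eq_iff)
  then have "M \<in> range ?l"
    using rangeI[of ?l 0] by (simp only:)
  moreover have "?l t \<in> range ?l"
    by (rule rangeI)
  ultimately show ?thesis
    unfolding connected_component_of_def
    using connectedin_line[of M N O4, OF assms] by (intro exI[of _ "range ?l"] conjI)
qed

inductive_set elementary :: "'a::comm_ring_1 mat2 set" where
  upper: "Mat2 1 t 0 1 \<in> elementary" |
  lower: "Mat2 1 0 t 1 \<in> elementary"

lemma det2_elementary: "E \<in> elementary \<Longrightarrow> det2 E = 1"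
  by (induction rule: elementary.induct) simp_all

text \<open>
  If \<open>c \<noteq> 0\<close>, three factors suffice; otherwise adding the first row to the second one
  reduces to that case.
\<close>

lemma SL2_elementary:
  fixes P :: "'k::field mat2"
  assumes "det2 P = 1"
  shows "\<exists>Es. set Es \<subseteq> elementary \<and> P = prod_list Es"
proof -
  have *: "\<exists>Es. set Es \<subseteq> elementary \<and> Mat2 a b c d = prod_list Es"
    if "a * d - b * c = 1" "c \<noteq> 0" for a b c d :: 'k
  proof -
    have "Mat2 a b c d = prod_list [Mat2 1 ((a - 1) / c) 0 1, Mat2 1 0 c 1, Mat2 1 ((d - 1) / c) 0 1]"
      using that by (simp add: one_mat2_def field_simps)
    moreover have "set [Mat2 1 ((a - 1) / c) 0 1, Mat2 1 0 c 1, Mat2 1 ((d - 1) / c) 0 1]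
        \<subseteq> elementary"
      by (auto intro: elementary.intros)
    ultimately show ?thesis
      by blast
  qed
  obtain a b c d where P: "P = Mat2 a b c d"
    by (cases P)
  show ?thesis
  proof (cases "c = 0")
    case False
    then show ?thesis
      using *[of a d b c] assms by (simp add: P)
  next
    case True
    with assms have "a * d = 1" "a \<noteq> 0"
      by (auto simp: P)
    then have "\<exists>Es. set Es \<subseteq> elementary \<and> Mat2 a b a (b + d) = prod_list Es"
      by (intro *) (simp_all add: algebra_simps)
    then obtain Es where "set Es \<subseteq> elementary" "Mat2 a b a (b + d) = prod_list Es"
      by blast
    moreover have "P = Mat2 1 0 (- 1) 1 * Mat2 a b a (b + d)"
      by (simp add: P True)
    ultimately have "set (Mat2 1 0 (- 1) 1 # Es) \<subseteq> elementary"
      "P = prod_list (Mat2 1 0 (- 1) 1 # Es)"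
      by (auto intro: elementary.intros)
    then show ?thesis
      by blast
  qed
qed

lemma lr_mult_add:
  "lr_mult (P + P') Q = lr_mult P Q + lr_mult P' Q"
  "lr_mult P (Q + Q') = lr_mult P Q + lr_mult P Q'"
  by (rule matrix_eqI_to_mat2; simp add: to_mat2_lr_mult matrix_vector_mult_add_rdistrib to_mat2_add
      distrib_left distrib_right)+

lemma lr_mult_scal2:
  "lr_mult (scal2 c * P) Q $ a $ b = c * lr_mult P Q $ a $ b"
  "lr_mult P (scal2 c * Q) $ a $ b = c * lr_mult P Q $ a $ b"
proof -
  have *: "coord_entry a (scal2 c * x) = c * coord_entry a x" for x
    by (cases x; cases a) (simp_all add: scal2_def)
  have "P * x * (scal2 c * Q) = scal2 c * (P * x * Q)" for x
    by (metis mult.assoc scal2_commute)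
  then show "lr_mult P (scal2 c * Q) $ a $ b = c * lr_mult P Q $ a $ b"
    by (simp add: lr_mult_def *)
  show "lr_mult (scal2 c * P) Q $ a $ b = c * lr_mult P Q $ a $ b"
    by (simp add: lr_mult_def * mult.assoc)
qed

lemma elementary_line:
  assumes "E \<in> elementary"
  obtains N t where "E = 1 + scal2 t * N" "\<And>t. 1 + scal2 t * N \<in> elementary"
  using assms
proof cases
  case (upper t)
  then show ?thesis
    by (intro that[of t "Mat2 0 1 0 0"])
      (auto simp: one_mat2_def scal2_def intro: elementary.intros)
next
  case (lower t)
  then show ?thesis
    by (intro that[of t "Mat2 0 0 1 0"])
      (auto simp: one_mat2_def scal2_def intro: elementary.intros)
qed

text \<open>
  Removing an elementary factor from \<open>P\<close> or \<open>Q\<close> means moving along an affine line inside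
  \<open>O(4)\<close>, so \<open>lr_mult P Q\<close> is joined to the identity through finitely many lines.
\<close>

lemma lr_mult_in_SO4:
  fixes P Q :: "'k::alg_closed_field mat2"
  assumes char2: "(2 :: 'k) = 0" and P: "det2 P = 1" and Q: "det2 Q = 1"
  shows "lr_mult P Q \<in> SO4"
proof -
  have left: "joined (lr_mult (E * P) Q) (lr_mult P Q)"
    if E: "E \<in> elementary" and PQ: "det2 P = 1" "det2 Q = 1" for E P Q :: "'k mat2"
  proof -
    obtain N t where N: "E = 1 + scal2 t * N" "\<And>t. 1 + scal2 t * N \<in> elementary"
      using elementary_line[OF E] by blast
    have line: "(\<chi> a b. lr_mult P Q $ a $ b + t * lr_mult (N * P) Q $ a $ b) =
        lr_mult ((1 + scal2 t * N) * P) Q" for t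
      by (simp add: Finite_Cartesian_Product.vec_eq_iff distrib_right lr_mult_add lr_mult_scal2 mult.assoc)
    show ?thesis
      using joined_line[of "lr_mult P Q" "lr_mult (N * P) Q" t] PQ
      unfolding line N(1) by (simp add: lr_mult_in_O4 char2 det2_mult det2_elementary N(2))
  qed
  have right: "joined (lr_mult P (E * Q)) (lr_mult P Q)"
    if E: "E \<in> elementary" and PQ: "det2 P = 1" "det2 Q = 1" for E P Q :: "'k mat2"
  proof -
    obtain N t where N: "E = 1 + scal2 t * N" "\<And>t. 1 + scal2 t * N \<in> elementary"
      using elementary_line[OF E] by blast
    have line: "(\<chi> a b. lr_mult P Q $ a $ b + t * lr_mult P (N * Q) $ a $ b) =
        lr_mult P ((1 + scal2 t * N) * Q)" for t
      by (simp add: Finite_Cartesian_Product.vec_eq_iff distrib_right lr_mult_add lr_mult_scal2 mult.assoc)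
    show ?thesis
      using joined_line[of "lr_mult P Q" "lr_mult P (N * Q)" t] PQ
      unfolding line N(1) by (simp add: lr_mult_in_O4 char2 det2_mult det2_elementary N(2))
  qed
  have refl: "joined (lr_mult 1 1) (lr_mult (1 :: 'k mat2) 1)"
    using lr_mult_in_O4[OF char2, of 1 1]
    by (simp add: connected_component_of_refl topspace_zariski)
  have det: "det2 (prod_list Es) = 1" if "set Es \<subseteq> elementary" for Es :: "'k mat2 list"
    using that by (induction Es) (simp_all add: det2_mult det2_elementary)
  have Q': "joined (lr_mult 1 (prod_list Es)) (lr_mult (1 :: 'k mat2) 1)"
    if "set Es \<subseteq> elementary" for Es
    using that
  proof (induction Es)
    case (Cons E Es)
    have "joined (lr_mult 1 (E * prod_list Es)) (lr_mult 1 (prod_list Es))"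
      using Cons.prems by (intro right det) auto
    moreover have "joined (lr_mult 1 (prod_list Es)) (lr_mult 1 1)"
      using Cons by simp
    ultimately show ?case
      unfolding prod_list.Cons by (rule connected_component_of_trans)
  qed (simp add: refl)
  have P': "joined (lr_mult (prod_list Es) Q) (lr_mult (1 :: 'k mat2) Q)"
    if "set Es \<subseteq> elementary" for Es
    using that
  proof (induction Es)
    case Nil
    show ?case
      using lr_mult_in_O4[OF char2, of 1 Q] Q
      by (simp add: connected_component_of_refl topspace_zariski)
  next
    case (Cons E Es)
    have "joined (lr_mult (E * prod_list Es) Q) (lr_mult (prod_list Es) Q)"
      using Cons.prems Q by (intro left det) auto
    moreover have "joined (lr_mult (prod_list Es) Q) (lr_mult 1 Q)"
      using Cons by simp
    ultimately show ?case
      unfolding prod_list.Cons by (rule connected_component_of_trans)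
  qed
  obtain Es Fs where Es: "set Es \<subseteq> elementary" "P = prod_list Es"
    and Fs: "set Fs \<subseteq> elementary" "Q = prod_list Fs"
    using SL2_elementary[OF P] SL2_elementary[OF Q] by blast
  have "joined (lr_mult P Q) (lr_mult 1 1)"
    using connected_component_of_trans[OF P'[OF Es(1)] Q'[OF Fs(1), folded Fs(2)]] Es(2) by simp
  then show ?thesis
    by (simp add: SO4_def lr_mult_1 connected_component_of_sym)
qed

section \<open>Classification of the orthogonal maps\<close>

text \<open>
  By Cayley-Hamilton, \<open>e\<close> is an idempotent of rank one. The columns of \<open>S\<close> are a vector in its image and a
  vector in its kernel.
\<close>

lemma idempotent_conjugate:
  fixes e :: "'k::field mat2"
  assumes "det2 e = 0" "tr2 e = 1"
  shows "\<exists>S. det2 S = 1 \<and> e = S * Mat2 1 0 0 0 * adj2 S"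
proof -
  obtain a b c d where e: "e = Mat2 a b c d"
    by (cases e)
  have d: "d = 1 - a"
    using assms(2) by (simp add: e eq_diff_eq add.commute)
  have bc: "b * c = a * (1 - a)"
    using assms(1) by (simp add: e d)
  consider "a \<noteq> 0" | "a = 0" "c = 0" | "a = 0" "b = 0"
    using bc by (cases "a = 0") auto
  then show ?thesis
  proof cases
    case 1
    then have "det2 (Mat2 a (- b / a) c 1) = 1"
      using bc by simp
    moreover have "e = Mat2 a (- b / a) c 1 * Mat2 1 0 0 0 * adj2 (Mat2 a (- b / a) c 1)"
      using 1 bc by (simp add: e d field_simps)
    ultimately show ?thesis
      by blast
  next
    case 2
    then show ?thesis
      by (intro exI[of _ "Mat2 b (- 1) 1 0"]) (simp add: e d)
  next
    case 3
    then show ?thesis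
      by (intro exI[of _ "Mat2 0 (- 1) 1 c"]) (simp add: e d)
  qed
qed

lemma linear_mat2:
  assumes add: "\<And>x y. \<phi> (x + y) = \<phi> x + (\<phi> y :: 'k::comm_ring_1 mat2)"
    and smult: "\<And>c x. \<phi> (scal2 c * x) = scal2 c * \<phi> x"
  shows "\<phi> (Mat2 a b c d) = scal2 a * \<phi> (Mat2 1 0 0 0) + scal2 b * \<phi> (Mat2 0 1 0 0) +
    scal2 c * \<phi> (Mat2 0 0 1 0) + scal2 d * \<phi> (Mat2 0 0 0 1)"
  unfolding add[symmetric] smult[symmetric] by (simp add: scal2_def)

text \<open>
  The span of \<open>E\<^sub>1\<^sub>2\<close> and \<open>E\<^sub>2\<^sub>1\<close> is the orthogonal complement of the diagonal matrices and
  so is mapped to itself. It contains just two isotropic lines, which are either kept or exchanged.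
  The two scalars that remain are mutually inverse and are absorbed by square roots.
\<close>

lemma det2_preserver_fixing_diagonal:
  fixes \<phi> :: "'k::alg_closed_field mat2 \<Rightarrow> 'k mat2"
  assumes char2: "(2 :: 'k) = 0"
    and add: "\<And>x y. \<phi> (x + y) = \<phi> x + \<phi> y"
    and smult: "\<And>c x. \<phi> (scal2 c * x) = scal2 c * \<phi> x"
    and det: "\<And>x. det2 (\<phi> x) = det2 x"
    and fix11: "\<phi> (Mat2 1 0 0 0) = Mat2 1 0 0 0" and fix22: "\<phi> (Mat2 0 0 0 1) = Mat2 0 0 0 1"
  shows "\<exists>P Q. det2 P = 1 \<and> det2 Q = 1 \<and>
    ((\<forall>x. \<phi> x = P * x * Q) \<or> (\<forall>x. \<phi> x = P * adj2 x * Q))"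
proof -
  have neg: "- x = x" for x :: 'k
    using mult_2[of x] char2 by (simp add: neg_eq_iff_add_eq_0)
  have polar: "tr2 (adj2 (\<phi> y) * \<phi> x) = tr2 (adj2 y * x)" for x y
    using det2_add[of "\<phi> x" "\<phi> y"] det2_add[of x y] by (simp add: det flip: add)
  obtain a b c d where E12: "\<phi> (Mat2 0 1 0 0) = Mat2 a b c d"
    by (cases "\<phi> (Mat2 0 1 0 0)")
  obtain a' b' c' d' where E21: "\<phi> (Mat2 0 0 1 0) = Mat2 a' b' c' d'"
    by (cases "\<phi> (Mat2 0 0 1 0)")
  have "a = 0" "d = 0" "a' = 0" "d' = 0"
    using polar[of "Mat2 0 0 0 1" "Mat2 0 1 0 0"] polar[of "Mat2 1 0 0 0" "Mat2 0 1 0 0"]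
      polar[of "Mat2 0 0 0 1" "Mat2 0 0 1 0"] polar[of "Mat2 1 0 0 0" "Mat2 0 0 1 0"]
    by (simp_all add: E12 E21 fix11 fix22)
  note diag = this
  have bc: "b * c = 0" and bc': "b' * c' = 0"
    using det[of "Mat2 0 1 0 0"] det[of "Mat2 0 0 1 0"] by (simp_all add: E12 E21 diag)
  have cross: "b' * c + c' * b = 1"
    using polar[of "Mat2 0 0 1 0" "Mat2 0 1 0 0"] by (simp add: E12 E21 diag neg)
  have \<phi>: "\<phi> (Mat2 p q r t) = Mat2 p (q * b + r * b') (q * c + r * c') t" for p q r t
    by (subst linear_mat2[of \<phi>, OF add smult])
      (simp add: E12 E21 fix11 fix22 diag scal2_def)
  show ?thesis
  proof (cases "b = 0")
    case False
    then have c: "c = 0"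
      using bc by simp
    then have c': "c' = 1 / b" and b': "b' = 0"
      using cross bc' False by (auto simp: field_simps)
    (* Conjugation by the diagonal matrix with entries s and 1 / s multiplies E_12 by b. *)
    obtain s where s: "s ^ 2 = b"
      using nth_root_exists[of 2 b] by auto
    have s0: "s \<noteq> 0"
      using s False by auto
    have "\<phi> x = Mat2 s 0 0 (1 / s) * x * Mat2 (1 / s) 0 0 s" for x
      using s0 by (cases x) (simp add: \<phi> c c' b' field_simps power2_eq_square flip: s)
    then show ?thesis
      using s0 by (intro exI[of _ "Mat2 s 0 0 (1 / s)"] exI[of _ "Mat2 (1 / s) 0 0 s"]) simp
  next
    case True
    then have b'c: "b' * c = 1"
      using cross by simp
    then have "c \<noteq> 0" "b' \<noteq> 0"
      by auto
    then have b': "b' = 1 / c" and c': "c' = 0"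
      using b'c bc' by (simp_all add: eq_divide_eq)
    obtain s where s: "s ^ 2 = c"
      using nth_root_exists[of 2 c] by auto
    have s0: "s \<noteq> 0"
      using s \<open>c \<noteq> 0\<close> by auto
    have "\<phi> x = Mat2 0 (1 / s) s 0 * adj2 x * Mat2 0 (1 / s) s 0" for x
      using s0 by (cases x)
        (simp add: \<phi> True c' b' neg field_simps power2_eq_square flip: s)
    then show ?thesis
      using s0 neg[of 1] by (intro exI[of _ "Mat2 0 (1 / s) s 0"]) simp
  qed
qed

text \<open>
  Dividing by \<open>\<phi> 1\<close>, one may assume \<open>\<phi> 1 = 1\<close>. Then \<open>\<phi>\<close> preserves the trace, which is the polar form
  with \<open>1\<close>, so that \<open>E\<^sub>1\<^sub>1\<close> has an image of trace \<open>1\<close> and determinant \<open>0\<close>, a conjugate of \<open>E\<^sub>1\<^sub>1\<close>.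
  After a conjugation, \<open>E\<^sub>1\<^sub>1\<close> and \<open>E\<^sub>2\<^sub>2 = 1 - E\<^sub>1\<^sub>1\<close> are fixed.
\<close>

lemma det2_preserver:
  fixes \<phi> :: "'k::alg_closed_field mat2 \<Rightarrow> 'k mat2"
  assumes char2: "(2 :: 'k) = 0"
    and add: "\<And>x y. \<phi> (x + y) = \<phi> x + \<phi> y"
    and smult: "\<And>c x. \<phi> (scal2 c * x) = scal2 c * \<phi> x"
    and det: "\<And>x. det2 (\<phi> x) = det2 x"
  shows "\<exists>P Q. det2 P = 1 \<and> det2 Q = 1 \<and>
    ((\<forall>x. \<phi> x = P * x * Q) \<or> (\<forall>x. \<phi> x = P * adj2 x * Q))"
proof -
  have one: "Mat2 1 0 0 0 + Mat2 0 0 0 1 = (1 :: 'k mat2)"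
    by (simp add: one_mat2_def)
  have polar: "tr2 (adj2 (\<phi> y) * \<phi> x) = tr2 (adj2 y * x)" for x y
    using det2_add[of "\<phi> x" "\<phi> y"] det2_add[of x y] by (simp add: det flip: add)
  define e where "e = adj2 (\<phi> 1) * \<phi> (Mat2 1 0 0 0)"
  have "det2 e = 0"
    by (simp add: e_def det2_mult det)
  moreover have "tr2 e = 1"
    using polar[of 1 "Mat2 1 0 0 0"] by (simp add: e_def) (simp add: one_mat2_def)
  ultimately obtain S where S: "det2 S = 1" "e = S * Mat2 1 0 0 0 * adj2 S"
    using idempotent_conjugate by blast
  have SS: "adj2 S * S = 1" "S * adj2 S = 1"
    by (simp_all add: mult_adj2 S)
  have \<phi>1: "\<phi> 1 * adj2 (\<phi> 1) = 1" "adj2 (\<phi> 1) * \<phi> 1 = 1"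
    by (simp_all add: mult_adj2 det)
  define \<psi> where "\<psi> x = adj2 S * (adj2 (\<phi> 1) * \<phi> x) * S" for x
  have \<phi>_eq: "\<phi> x = (\<phi> 1 * S) * \<psi> x * adj2 S" for x
  proof -
    have "(\<phi> 1 * S) * \<psi> x * adj2 S = \<phi> 1 * (S * adj2 S) * adj2 (\<phi> 1) * \<phi> x * (S * adj2 S)"
      by (simp only: \<psi>_def mult.assoc)
    then show ?thesis
      by (simp add: SS \<phi>1)
  qed
  have "\<exists>P Q. det2 P = 1 \<and> det2 Q = 1 \<and>
    ((\<forall>x. \<psi> x = P * x * Q) \<or> (\<forall>x. \<psi> x = P * adj2 x * Q))"
  proof (rule det2_preserver_fixing_diagonal[OF char2])
    show \<psi>_add: "\<psi> (x + y) = \<psi> x + \<psi> y" for x y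
      by (simp add: \<psi>_def add distrib_left distrib_right)
    show "\<psi> (scal2 c * x) = scal2 c * \<psi> x" for c x
      unfolding \<psi>_def smult by (simp only: mult.assoc scal2_left_commute)
    show "det2 (\<psi> x) = det2 x" for x
      by (simp add: \<psi>_def det2_mult det S)
    show E11: "\<psi> (Mat2 1 0 0 0) = Mat2 1 0 0 0"
    proof -
      have "\<psi> (Mat2 1 0 0 0) = (adj2 S * S) * Mat2 1 0 0 0 * (adj2 S * S)"
        unfolding \<psi>_def e_def[symmetric] S(2) by (simp only: mult.assoc)
      then show ?thesis
        by (simp only: SS mult_1_left mult_1_right)
    qed
    have "\<psi> 1 = 1"
      by (simp add: \<psi>_def \<phi>1 SS)
    then have "\<psi> (Mat2 1 0 0 0) + \<psi> (Mat2 0 0 0 1) = Mat2 1 0 0 0 + Mat2 0 0 0 1"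
      by (simp only: one flip: \<psi>_add)
    then show "\<psi> (Mat2 0 0 0 1) = Mat2 0 0 0 1"
      by (simp only: E11 add_left_cancel)
  qed
  then obtain P Q where PQ: "det2 P = 1" "det2 Q = 1"
    "(\<forall>x. \<psi> x = P * x * Q) \<or> (\<forall>x. \<psi> x = P * adj2 x * Q)"
    by blast
  have "(\<forall>x. \<phi> x = (\<phi> 1 * S * P) * x * (Q * adj2 S)) \<or>
      (\<forall>x. \<phi> x = (\<phi> 1 * S * P) * adj2 x * (Q * adj2 S))"
    using PQ(3) by (subst (1 3) \<phi>_eq) (auto simp: mult.assoc)
  moreover have "det2 (\<phi> 1 * S * P) = 1" "det2 (Q * adj2 S) = 1"
    by (simp_all add: det2_mult det S PQ)
  ultimately show ?thesis
    by blast
qed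

lemma O4_cases:
  fixes h :: "'k::alg_closed_field ^ coord ^ coord"
  assumes char2: "(2 :: 'k) = 0" and h: "h \<in> O4"
  obtains P Q where "det2 P = 1" "det2 Q = 1" "\<And>v. to_mat2 (h *v v) = P * to_mat2 v * Q"
  | P Q where "det2 P = 1" "det2 Q = 1" "\<And>v. to_mat2 (h *v v) = P * adj2 (to_mat2 v) * Q"
proof -
  define \<phi> where "\<phi> x = to_mat2 (h *v of_mat2 x)" for x
  have "\<exists>P Q. det2 P = 1 \<and> det2 Q = 1 \<and>
    ((\<forall>x. \<phi> x = P * x * Q) \<or> (\<forall>x. \<phi> x = P * adj2 x * Q))"
  proof (rule det2_preserver[OF char2])
    show "\<phi> (x + y) = \<phi> x + \<phi> y" for x y
      by (simp add: \<phi>_def of_mat2_add matrix_vector_right_distrib to_mat2_add)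
    show "\<phi> (scal2 c * x) = scal2 c * \<phi> x" for c x
      by (simp add: \<phi>_def of_mat2_smult vector_scalar_commute to_mat2_smult)
    show "det2 (\<phi> x) = det2 x" for x
      using h by (simp add: \<phi>_def O4_def flip: quad_form_eq_det2[OF char2])
        (simp add: quad_form_eq_det2[OF char2])
  qed
  moreover have "to_mat2 (h *v v) = \<phi> (to_mat2 v)" for v
    by (simp add: \<phi>_def)
  ultimately show thesis
    using that by metis
qed

lemma matrix_inv_O4:
  assumes "g \<in> O4"
  shows "matrix_inv g \<in> O4" "g ** matrix_inv g = Finite_Cartesian_Product.mat 1"
    "matrix_inv g ** g = Finite_Cartesian_Product.mat 1"
proof -
  from assms have "\<exists>g'. g ** g' = Finite_Cartesian_Product.mat 1 \<and>
      g' ** g = Finite_Cartesian_Product.mat 1"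
    by (simp add: O4_def invertible_def)
  from someI_ex[OF this] show inv: "g ** matrix_inv g = Finite_Cartesian_Product.mat 1"
    "matrix_inv g ** g = Finite_Cartesian_Product.mat 1"
    by (simp_all add: matrix_inv_def)
  have "quad_form (matrix_inv g *v v) = quad_form v" for v
  proof -
    have "quad_form (g *v (matrix_inv g *v v)) = quad_form (matrix_inv g *v v)"
      using assms by (simp add: O4_def)
    then show ?thesis
      by (simp add: matrix_vector_mul_assoc inv)
  qed
  then show "matrix_inv g \<in> O4"
    using inv by (auto simp: O4_def invertible_def)
qed

section \<open>Invariance of \<open>G\<close>\<close>

text \<open>
  As \<open>adj P P = 1\<close> and \<open>Q adj Q = 1\<close>, the product telescopes to a conjugate by \<open>Q\<close>.
\<close>

lemma cyclic_trace_lr_mult: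
  assumes "det2 P = 1" "det2 Q = 1" "length il = length jl"
  shows "cyclic_trace (map (\<lambda>i. P * A i * Q) il) (map (\<lambda>i. P * A i * Q) jl) =
    cyclic_trace (map A il) (map A jl)"
proof -
  have "prod_list (map2 (\<lambda>a b. adj2 a * b) (map (\<lambda>i. P * A i * Q) il) (map (\<lambda>i. P * A i * Q) jl)) =
      adj2 Q * prod_list (map2 (\<lambda>a b. adj2 a * b) (map A il) (map A jl)) * Q"
    using assms(3)
  proof (induction il jl rule: list_induct2)
    case Nil
    show ?case
      by (simp add: mult_adj2 assms)
  next
    case (Cons i il j jl)
    let ?p = "prod_list (map2 (\<lambda>a b. adj2 a * b) (map A il) (map A jl))"
    have "adj2 (P * A i * Q) * (P * A j * Q) * (adj2 Q * ?p * Q) =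
        adj2 Q * adj2 (A i) * (adj2 P * P) * A j * (Q * adj2 Q) * ?p * Q"
      by (simp only: adj2_mult mult.assoc)
    also have "\<dots> = adj2 Q * (adj2 (A i) * A j * ?p) * Q"
      by (simp add: mult_adj2 assms mult.assoc)
    finally show ?case
      using Cons.IH by simp
  qed
  moreover have "tr2 (adj2 Q * x * Q) = tr2 x" for x
    using tr2_mult_commute[of "adj2 Q * x" Q] by (simp add: mult_adj2 assms flip: mult.assoc)
  ultimately show ?thesis
    by (simp add: cyclic_trace_def)
qed

lemma comm_ring_hom_act: "comm_ring_hom (act g)"
  unfolding act_def by (rule comm_ring_hom_subst_poly)

lemma act_Var:
  "act g (Var (c, i)) = (\<Sum>d\<in>UNIV. Const (coord_entry c (to_mat2 (matrix_inv g *v axis d 1))) * Var (d, i))"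
proof -
  have "coord_entry c (to_mat2 (h *v axis d 1)) = h $ c $ d" for h :: "'a ^ coord ^ coord" and d
    by (simp add: matrix_vector_mult_def axis_def if_distrib cong: if_cong)
  then show ?thesis
    by (simp add: act_def)
qed

lemma map_act_vec_mat2:
  assumes "\<And>v. to_mat2 (matrix_inv g *v v) = P * to_mat2 v * Q"
  shows "map_mat2 (act g) (vec_mat2 i) = map_mat2 Const P * vec_mat2 i * map_mat2 Const Q"
  by (cases P; cases Q)
    (simp add: vec_mat2_def act_Var assms sum_coord to_mat2_axis Const_add Const_mult algebra_simps)

lemma map_act_vec_mat2_adj2:
  assumes "\<And>v. to_mat2 (matrix_inv g *v v) = P * adj2 (to_mat2 v) * Q"
  shows "map_mat2 (act g) (vec_mat2 i) = map_mat2 Const P * adj2 (vec_mat2 i) * map_mat2 Const Q"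
  by (cases P; cases Q)
    (simp add: vec_mat2_def act_Var assms sum_coord to_mat2_axis Const_add Const_mult Const_uminus
      algebra_simps)

text \<open>
  The polynomials \<open>F\<close> and \<open>\<sigma>F\<close>.
\<close>

definition trace_inv :: "nat list \<Rightarrow> nat list \<Rightarrow> (coord \<times> nat, 'k::field) mpoly" where
  "trace_inv il jl = cyclic_trace (map vec_mat2 il) (map vec_mat2 jl)"

definition trace_inv' :: "nat list \<Rightarrow> nat list \<Rightarrow> (coord \<times> nat, 'k::field) mpoly" where
  "trace_inv' il jl = cyclic_trace (map (\<lambda>i. adj2 (vec_mat2 i)) il) (map (\<lambda>i. adj2 (vec_mat2 i)) jl)"

lemma act_trace_inv:
  fixes g :: "'k::alg_closed_field ^ coord ^ coord"
  assumes char2: "(2 :: 'k) = 0" and g: "g \<in> O4" and len: "length il = length jl"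
  shows "act g (trace_inv il jl) = trace_inv il jl \<and> act g (trace_inv' il jl) = trace_inv' il jl \<and>
      g \<in> SO4 \<or>
    act g (trace_inv il jl) = trace_inv' il jl \<and> act g (trace_inv' il jl) = trace_inv il jl"
proof -
  interpret act: comm_ring_hom "act g"
    by (rule comm_ring_hom_act)
  interpret Const: comm_ring_hom "Const :: 'k \<Rightarrow> (coord \<times> nat, 'k) mpoly"
    by (rule comm_ring_hom_Const)
  let ?C = "map_mat2 Const :: 'k mat2 \<Rightarrow> (coord \<times> nat, 'k) mpoly mat2"
  have det_C: "det2 (?C P) = 1" "det2 (adj2 (?C P)) = 1" if "det2 P = 1" for P
    using that by (simp_all add: Const.det2_map_mat2)
  have act_T: "act g (trace_inv il jl) =
      cyclic_trace (map (\<lambda>i. map_mat2 (act g) (vec_mat2 i)) il) (map (\<lambda>i. map_mat2 (act g) (vec_mat2 i)) jl)"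
    "act g (trace_inv' il jl) =
      cyclic_trace (map (\<lambda>i. adj2 (map_mat2 (act g) (vec_mat2 i))) il)
        (map (\<lambda>i. adj2 (map_mat2 (act g) (vec_mat2 i))) jl)"
    unfolding trace_inv_def trace_inv'_def act.hom_cyclic_trace
    by (simp_all add: comp_def act.map_mat2_adj2)
  show ?thesis
    using char2 matrix_inv_O4(1)[OF g]
  proof (cases rule: O4_cases)
    case (1 P Q)
    have "matrix_inv g = lr_mult P Q"
      by (rule matrix_eqI_to_mat2) (simp add: 1 to_mat2_lr_mult)
    then have "g = lr_mult (adj2 P) (adj2 Q)"
      using matrix_inv_O4(2)[OF g] lr_mult_inverse[OF 1(1,2)]
      by (metis matrix_mul_assoc matrix_mul_lid matrix_mul_rid)
    then have "g \<in> SO4"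
      using 1 by (simp add: lr_mult_in_SO4 char2)
    moreover have "act g (trace_inv il jl) = trace_inv il jl"
      unfolding act_T map_act_vec_mat2[OF 1(3)]
      unfolding trace_inv_def
      by (intro cyclic_trace_lr_mult det_C 1 len)
    moreover have "act g (trace_inv' il jl) = trace_inv' il jl"
      unfolding act_T map_act_vec_mat2[OF 1(3)]
      unfolding trace_inv'_def adj2_mult mult.assoc[symmetric]
      by (intro cyclic_trace_lr_mult det_C 1 len)
    ultimately show ?thesis
      by blast
  next
    case (2 P Q)
    have "act g (trace_inv il jl) = trace_inv' il jl"
      unfolding act_T map_act_vec_mat2_adj2[OF 2(3)]
      unfolding trace_inv'_def
      by (intro cyclic_trace_lr_mult det_C 2 len)
    moreover have "act g (trace_inv' il jl) = trace_inv il jl"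
      unfolding act_T map_act_vec_mat2_adj2[OF 2(3)]
      unfolding trace_inv_def adj2_mult adj2_adj2
        mult.assoc[symmetric]
      by (intro cyclic_trace_lr_mult det_C 2 len)
    ultimately show ?thesis
      by blast
  qed
qed

lemma R4_add: "p \<in> R4 m \<Longrightarrow> q \<in> R4 m \<Longrightarrow> p + q \<in> R4 m"
  using keys_add[of p q] by (fastforce simp: R4_def poly_vars_def)

lemma R4_uminus: "p \<in> R4 m \<Longrightarrow> - p \<in> R4 m"
  by (simp add: R4_def poly_vars_def)

lemma R4_mult:
  assumes "p \<in> R4 m" "q \<in> R4 m"
  shows "p * q \<in> R4 m"
proof -
  have "Poly_Mapping.keys u \<subseteq> UNIV \<times> {1..m}" if "u \<in> Poly_Mapping.keys (p * q)" for u
  proof -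
    obtain v w where "u = v + w" "v \<in> Poly_Mapping.keys p" "w \<in> Poly_Mapping.keys q"
      using keys_mult[of p q] \<open>u \<in> _\<close> by blast
    then show ?thesis
      using keys_add[of v w] assms unfolding R4_def poly_vars_def by blast
  qed
  then show ?thesis
    by (auto simp: R4_def poly_vars_def)
qed

lemma R4_cyclic_trace:
  fixes A :: "nat \<Rightarrow> (coord \<times> nat, 'k::field) mpoly mat2"
  assumes "\<And>i. i \<in> set il \<union> set jl \<Longrightarrow> pred_mat2 (\<lambda>p. p \<in> R4 m) (A i)" and "length il = length jl"
  shows "cyclic_trace (map A il) (map A jl) \<in> R4 m"
proof -
  have mult: "pred_mat2 (\<lambda>p. p \<in> R4 m) (x * y)"
    if "pred_mat2 (\<lambda>p. p \<in> R4 m) x" "pred_mat2 (\<lambda>p. p \<in> R4 m) y"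
    for x y :: "(coord \<times> nat, 'k) mpoly mat2"
    using that by (cases x; cases y) (simp add: R4_add R4_mult)
  have adj: "pred_mat2 (\<lambda>p. p \<in> R4 m) (adj2 x)" if "pred_mat2 (\<lambda>p. p \<in> R4 m) x"
    for x :: "(coord \<times> nat, 'k) mpoly mat2"
    using that by (cases x) (simp add: R4_uminus)
  have "pred_mat2 (\<lambda>p. p \<in> R4 m) (prod_list (map2 (\<lambda>a b. adj2 a * b) (map A il) (map A jl)))"
    using assms(2,1)
  proof (induction il jl rule: list_induct2)
    case Nil
    show ?case
      by (simp add: one_mat2_def R4_def poly_vars_def)
  next
    case (Cons i il j jl)
    then show ?case
      by (simp add: mult adj)
  qed
  then show ?thesis
    unfolding cyclic_trace_def
    by (cases "prod_list (map2 (\<lambda>a b. adj2 a * b) (map A il) (map A jl))") (simp add: R4_add)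
qed

lemma R4_trace_inv:
  assumes "set (il @ jl) \<subseteq> {1..m}" "length il = length jl"
  shows "trace_inv il jl \<in> (R4 m :: (coord \<times> nat, 'k::field) mpoly set)" (is ?T)
    and "trace_inv' il jl \<in> (R4 m :: (coord \<times> nat, 'k) mpoly set)" (is ?T')
proof -
  have "(Var (c, i) :: (coord \<times> nat, 'k) mpoly) \<in> R4 m" if "i \<in> {1..m}" for c i
    using that by (simp add: R4_def poly_vars_def)
  then have "pred_mat2 (\<lambda>p. p \<in> R4 m) (vec_mat2 i :: (coord \<times> nat, 'k) mpoly mat2)"
    "pred_mat2 (\<lambda>p. p \<in> R4 m) (adj2 (vec_mat2 i) :: (coord \<times> nat, 'k) mpoly mat2)"
    if "i \<in> set il \<union> set jl" for i
    using that assms by (auto simp: vec_mat2_def intro!: R4_uminus)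
  then show ?T ?T'
    unfolding trace_inv_def trace_inv'_def by (blast intro: R4_cyclic_trace assms(2))+
qed

section \<open>Parity of the specialisations of invariants\<close>

lemma sum_involution_char2:
  fixes f :: "'a \<Rightarrow> 'b::comm_monoid_add"
  assumes "finite A" and double: "\<And>b :: 'b. b + b = 0"
    and "\<And>x. x \<in> A \<Longrightarrow> \<tau> x \<in> A \<and> \<tau> x \<noteq> x \<and> \<tau> (\<tau> x) = x \<and> f (\<tau> x) = f x"
  shows "sum f A = 0"
  using assms(1,3)
proof (induction A rule: finite_psubset_induct)
  case (psubset A)
  show ?case
  proof (cases "A = {}")
    case False
    then obtain x where x: "x \<in> A"
      by blast
    let ?B = "A - {x, \<tau> x}"
    have "sum f ?B = 0"
    proof (rule psubset.IH)
      show "?B \<subset> A"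
        using x by blast
      fix y
      assume "y \<in> ?B"
      then have y: "y \<in> A" "y \<noteq> x" "y \<noteq> \<tau> x"
        by auto
      note \<tau>x = psubset.prems[OF x] and \<tau>y = psubset.prems[OF y(1)]
      have "\<tau> y \<noteq> x" "\<tau> y \<noteq> \<tau> x"
        using \<tau>x \<tau>y y(2,3) by metis+
      with \<tau>y show "\<tau> y \<in> ?B \<and> \<tau> y \<noteq> y \<and> \<tau> (\<tau> y) = y \<and> f (\<tau> y) = f y"
        by blast
    qed
    moreover have "sum f A = sum f {x, \<tau> x} + sum f ?B"
      using x psubset.prems[OF x] psubset.hyps
      by (subst sum.subset_diff[of "{x, \<tau> x}"]) (auto simp: add.commute)
    moreover have "sum f {x, \<tau> x} = 0"
      using psubset.prems[OF x] by (subst sum.insert) (auto simp: double)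
    ultimately show ?thesis
      by simp
  qed simp
qed

lemma Var_power: "Var x ^ n = Poly_Mapping.single (Poly_Mapping.single x n) 1"
  by (induction n) (simp_all add: Var_def mult_single flip: single_add)

lemma prod_single: "(\<Prod>x\<in>K. Poly_Mapping.single (a x) 1) = Poly_Mapping.single (\<Sum>x\<in>K. a x) (1 :: 'k::comm_semiring_1)"
  by (induction K rule: infinite_finite_induct) (simp_all add: mult_single)

lemma monom_value_Var_involution:
  assumes "\<And>x. \<pi> (\<pi> x) = x"
  shows "monom_value (\<lambda>x. Var (\<pi> x)) v =
    Poly_Mapping.single (Poly_Mapping.map_key \<pi> v) (1 :: 'k::comm_semiring_1)"
proof -
  have inj: "inj \<pi>"
    by (metis assms injI)
  have "(\<Sum>x\<in>Poly_Mapping.keys v. Poly_Mapping.single (\<pi> x) (Poly_Mapping.lookup v x)) =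
      Poly_Mapping.map_key \<pi> v"
  proof (rule poly_mapping_eqI)
    fix y
    have "Poly_Mapping.lookup (Poly_Mapping.single (\<pi> x) (Poly_Mapping.lookup v x)) y =
        (if x = \<pi> y then Poly_Mapping.lookup v (\<pi> y) else 0)" for x
      using assms by (auto simp: lookup_single when_def)
    then show "Poly_Mapping.lookup
          (\<Sum>x\<in>Poly_Mapping.keys v. Poly_Mapping.single (\<pi> x) (Poly_Mapping.lookup v x)) y =
        Poly_Mapping.lookup (Poly_Mapping.map_key \<pi> v) y"
      by (simp add: lookup_sum map_key.rep_eq[OF inj] in_keys_iff)
  qed
  then show ?thesis
    by (simp add: monom_value_def Var_power prod_single)
qed

lemma monom_value_Var: "monom_value Var v = Poly_Mapping.single v (1 :: 'k::comm_semiring_1)"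
  using monom_value_Var_involution[of "\<lambda>x. x" v] by (simp add: map_key_id)

lemma lookup_subst_Var_involution:
  fixes p :: "('v, 'k::comm_semiring_1) mpoly"
  assumes "\<And>x. \<pi> (\<pi> x) = x"
  shows "Poly_Mapping.lookup (subst_poly (\<lambda>x. Var (\<pi> x)) p) (Poly_Mapping.map_key \<pi> v) =
    Poly_Mapping.lookup p v"
proof -
  have inj: "inj \<pi>"
    by (metis assms injI)
  have "Poly_Mapping.map_key \<pi> (Poly_Mapping.map_key \<pi> w) = w" for w :: "'v \<Rightarrow>\<^sub>0 nat"
    by (rule poly_mapping_eqI) (simp add: map_key.rep_eq[OF inj] assms)
  then have "Poly_Mapping.map_key \<pi> w = Poly_Mapping.map_key \<pi> v \<longleftrightarrow> w = v" for w :: "'v \<Rightarrow>\<^sub>0 nat"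
    by metis
  then show ?thesis
    by (simp add: insertion_def monom_value_Var_involution[OF assms] Const_def mult_single
        lookup_sum lookup_single when_def in_keys_iff)
qed

definition even_poly :: "('v, 'k::zero) mpoly \<Rightarrow> bool" where
  "even_poly p \<longleftrightarrow> (\<forall>u\<in>Poly_Mapping.keys p. \<forall>x. even (Poly_Mapping.lookup u x))"

lemma even_poly_0 [simp]: "even_poly 0"
  by (simp add: even_poly_def)

lemma even_poly_Const [simp]: "even_poly (Const c)"
  by (simp add: even_poly_def Const_def)

lemma even_poly_1 [simp]: "even_poly 1"
  by (simp add: even_poly_def)

lemma even_poly_mult: "even_poly p \<Longrightarrow> even_poly q \<Longrightarrow> even_poly (p * q)"
  using keys_mult[of p q] unfolding even_poly_def by (fastforce simp: lookup_add)

lemma even_poly_Var_square: "even_poly (Var x * Var x :: ('v, 'k::comm_semiring_1) mpoly)"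
  by (simp add: Var_def mult_single even_poly_def lookup_add)

lemma even_poly_power: "even_poly p \<Longrightarrow> even_poly (p ^ n)"
  by (induction n) (simp_all add: even_poly_mult)

lemma even_poly_sum: "(\<And>i. i \<in> I \<Longrightarrow> even_poly (p i)) \<Longrightarrow> even_poly (sum p I)"
  using keys_sum[of p I] unfolding even_poly_def by blast

lemma even_poly_prod: "(\<And>i. i \<in> I \<Longrightarrow> even_poly (p i)) \<Longrightarrow> even_poly (prod p I)"
  by (induction I rule: infinite_finite_induct) (simp_all add: even_poly_mult)

text \<open>
  The reflection \<open>V \<mapsto> adj V\<close>, which in characteristic \<open>2\<close> merely permutes the coordinates.
\<close>

fun swap_xy :: "coord \<times> nat \<Rightarrow> coord \<times> nat" where
  "swap_xy (X1, i) = (Y1, i)" |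
  "swap_xy (Y1, i) = (X1, i)" |
  "swap_xy (X2, i) = (X2, i)" |
  "swap_xy (Y2, i) = (Y2, i)"

lemma swap_xy_swap_xy [simp]: "swap_xy (swap_xy x) = x"
  by (induction x rule: swap_xy.induct) simp_all

lemma inj_swap_xy: "inj swap_xy"
  by (metis swap_xy_swap_xy injI)

lemma monom_value_swap_xy:
  assumes \<delta>: "\<And>x. \<delta> (swap_xy x) = \<delta> x"
  shows "monom_value \<delta> (Poly_Mapping.map_key swap_xy v) = monom_value \<delta> v"
proof -
  let ?K = "Poly_Mapping.keys v \<union> swap_xy ` Poly_Mapping.keys v"
  have K: "bij_betw swap_xy ?K ?K"
    by (rule bij_betwI[where g = swap_xy]) auto
  have keys: "Poly_Mapping.keys (Poly_Mapping.map_key swap_xy v) \<subseteq> ?K"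
  proof
    fix x assume "x \<in> Poly_Mapping.keys (Poly_Mapping.map_key swap_xy v)"
    then have "swap_xy x \<in> Poly_Mapping.keys v"
      by (simp add: in_keys_iff map_key.rep_eq[OF inj_swap_xy])
    then show "x \<in> ?K"
      by (metis UnI2 imageI swap_xy_swap_xy)
  qed
  have "monom_value \<delta> (Poly_Mapping.map_key swap_xy v) =
      (\<Prod>x\<in>?K. \<delta> (swap_xy x) ^ Poly_Mapping.lookup v (swap_xy x))"
    using keys by (simp add: monom_value_superset[of ?K] map_key.rep_eq[OF inj_swap_xy] \<delta>)
  also have "\<dots> = (\<Prod>x\<in>?K. \<delta> x ^ Poly_Mapping.lookup v x)"
    by (rule prod.reindex_bij_betw[OF K])
  also have "\<dots> = monom_value \<delta> v"
    by (simp add: monom_value_superset[of ?K])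
  finally show ?thesis .
qed

lemma even_poly_fixed_monomial:
  fixes \<delta> :: "coord \<times> nat \<Rightarrow> ('v, 'k::comm_semiring_1) mpoly"
  assumes \<delta>: "\<And>i. \<delta> (Y1, i) = \<delta> (X1, i)" "\<And>i. even_poly (\<delta> (X1, i) * \<delta> (X1, i))"
      "\<And>i. even_poly (\<delta> (X2, i))" "\<And>i. even_poly (\<delta> (Y2, i))"
    and v: "Poly_Mapping.map_key swap_xy v = v"
  shows "even_poly (monom_value \<delta> v)"
proof -
  let ?I = "snd ` Poly_Mapping.keys v"
  have v': "Poly_Mapping.lookup v (Y1, i) = Poly_Mapping.lookup v (X1, i)" for i
    using arg_cong[OF v, of "\<lambda>v. Poly_Mapping.lookup v (X1, i)"]
    by (simp add: map_key.rep_eq[OF inj_swap_xy])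
  have "monom_value \<delta> v = (\<Prod>x\<in>UNIV \<times> ?I. \<delta> x ^ Poly_Mapping.lookup v x)"
    by (rule monom_value_superset) force+
  also have "\<dots> = (\<Prod>c\<in>UNIV. \<Prod>i\<in>?I. \<delta> (c, i) ^ Poly_Mapping.lookup v (c, i))"
    by (simp add: prod.cartesian_product)
  also have "\<dots> = (\<Prod>i\<in>?I. (\<delta> (X1, i) * \<delta> (X1, i)) ^ Poly_Mapping.lookup v (X1, i)) *
      (\<Prod>i\<in>?I. \<delta> (X2, i) ^ Poly_Mapping.lookup v (X2, i)) *
      (\<Prod>i\<in>?I. \<delta> (Y2, i) ^ Poly_Mapping.lookup v (Y2, i))"
    by (simp add: UNIV_coord v' \<delta>(1) power_mult_distrib prod.distrib mult_ac)
  finally show ?thesis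
    by (auto intro!: even_poly_mult even_poly_prod even_poly_power \<delta>)
qed

text \<open>
  Mirror monomials of \<open>g\<close> have equal coefficients and equal images, and these cancel in
  characteristic \<open>2\<close>. The monomials that remain contain \<open>x\<^sub>1\<close> and \<open>y\<^sub>1\<close> of each vector to
  the same power, hence are mapped to powers of \<open>\<delta> (X1, i)\<^sup>2\<close> times even factors.
\<close>

lemma even_poly_subst_swap_invariant:
  fixes \<delta> :: "coord \<times> nat \<Rightarrow> ('v, 'k::field) mpoly"
  assumes char2: "(2 :: 'k) = 0"
    and inv: "\<And>v. Poly_Mapping.lookup g (Poly_Mapping.map_key swap_xy v) = Poly_Mapping.lookup g v"
    and \<delta>: "\<And>i. \<delta> (Y1, i) = \<delta> (X1, i)" "\<And>i. even_poly (\<delta> (X1, i) * \<delta> (X1, i))"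
      "\<And>i. even_poly (\<delta> (X2, i))" "\<And>i. even_poly (\<delta> (Y2, i))"
  shows "even_poly (subst_poly \<delta> g)"
proof -
  let ?sw = "Poly_Mapping.map_key swap_xy"
  let ?t = "\<lambda>v. Const (Poly_Mapping.lookup g v) * monom_value \<delta> v"
  let ?A = "{v \<in> Poly_Mapping.keys g. ?sw v \<noteq> v}" and ?B = "{v \<in> Poly_Mapping.keys g. ?sw v = v}"
  have "x + x = 0" for x :: 'k
    using mult_2[of x] char2 by simp
  then have double: "p + p = 0" for p :: "('v, 'k) mpoly"
    by (intro poly_mapping_eqI) (simp only: lookup_add lookup_zero)
  have "\<delta> (swap_xy x) = \<delta> x" for x
    by (induction x rule: swap_xy.induct) (simp_all add: \<delta>)
  note mv = monom_value_swap_xy[of \<delta>, OF this]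
  have sw: "?sw (?sw v) = v" for v :: "coord \<times> nat \<Rightarrow>\<^sub>0 nat"
    by (rule poly_mapping_eqI) (simp add: map_key.rep_eq[OF inj_swap_xy])
  have "sum ?t ?A = 0"
    by (rule sum_involution_char2[of _ ?sw]) (auto simp: double inv mv sw in_keys_iff)
  moreover have "subst_poly \<delta> g = sum ?t ?A + sum ?t ?B"
    unfolding insertion_def by (subst sum.union_disjoint[symmetric]) (auto intro: sum.cong)
  moreover have "even_poly (sum ?t ?B)"
    by (auto intro!: even_poly_sum even_poly_mult even_poly_fixed_monomial \<delta>)
  ultimately show ?thesis
    by simp
qed

lemma O4_invariant_swap:
  fixes g :: "(coord \<times> nat, 'k::field) mpoly"
  assumes "\<And>h. h \<in> O4 \<Longrightarrow> act h g = g"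
  shows "Poly_Mapping.lookup g (Poly_Mapping.map_key swap_xy v) = Poly_Mapping.lookup g v"
proof -
  define h :: "'k ^ coord ^ coord" where
    "h = (\<chi> c d. if (d, 0 :: nat) = swap_xy (c, 0) then 1 else 0)"
  have h: "h *v w = (\<chi> c. w $ fst (swap_xy (c, 0)))" for w
  proof -
    have "(h *v w) $ c = w $ fst (swap_xy (c, 0))" for c
      by (cases c) (simp_all add: h_def matrix_vector_mult_def sum_coord)
    then show ?thesis
      by (simp add: Finite_Cartesian_Product.vec_eq_iff)
  qed
  have inv: "h ** h = Finite_Cartesian_Product.mat 1"
  proof (rule matrix_eqI_to_mat2)
    show "to_mat2 ((h ** h) *v w) = to_mat2 (Finite_Cartesian_Product.mat 1 *v w)" for w
      by (simp add: h to_mat2_def flip: matrix_vector_mul_assoc)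
  qed
  then have h_O4: "h \<in> O4"
    by (auto simp: O4_def invertible_def h quad_form_def mult_ac)
  have "matrix_inv h ** (h ** h) = h"
    by (simp add: matrix_mul_assoc matrix_inv_O4(3)[OF h_O4])
  then have "matrix_inv h = h"
    by (simp add: inv)
  then have "(\<Sum>d\<in>UNIV. Const (matrix_inv h $ c $ d) * Var (d, i)) = Var (swap_xy (c, i))" for c i
    by (cases c) (simp_all add: h_def sum_coord)
  then have "act h = subst_poly (\<lambda>x. Var (swap_xy x))"
    unfolding act_def by (intro arg_cong[of _ _ subst_poly]) auto
  with assms[OF h_O4] have "subst_poly (\<lambda>x. Var (swap_xy x)) g = g"
    by simp
  with lookup_subst_Var_involution[of swap_xy g v] show ?thesis
    by simp
qed

section \<open>Degrees under substitution\<close>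

definition degree_le :: "nat \<Rightarrow> ('v, 'k::zero) mpoly \<Rightarrow> bool" where
  "degree_le n p \<longleftrightarrow> (\<forall>u\<in>Poly_Mapping.keys p. monom_degree u \<le> n)"

lemma monom_degree_superset:
  "finite K \<Longrightarrow> Poly_Mapping.keys u \<subseteq> K \<Longrightarrow> monom_degree u = (\<Sum>x\<in>K. Poly_Mapping.lookup u x)"
  unfolding monom_degree_def by (intro sum.mono_neutral_left) (auto simp: in_keys_iff)

lemma monom_degree_add: "monom_degree (u + w) = monom_degree u + monom_degree w"
proof -
  let ?K = "Poly_Mapping.keys u \<union> Poly_Mapping.keys w"
  have "Poly_Mapping.keys (u + w) \<subseteq> ?K"
    by (rule keys_add)
  then show ?thesis
    by (simp add: monom_degree_superset[of ?K] lookup_add sum.distrib)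
qed

lemma degree_le_one: "degree_le 0 1"
  by (simp add: degree_le_def monom_degree_def)

lemma degree_le_mult:
  assumes "degree_le m p" "degree_le n q"
  shows "degree_le (m + n) (p * q)"
  unfolding degree_le_def
proof
  fix u assume "u \<in> Poly_Mapping.keys (p * q)"
  with keys_mult[of p q] obtain v w
    where "u = v + w" "v \<in> Poly_Mapping.keys p" "w \<in> Poly_Mapping.keys q"
    by blast
  with assms show "monom_degree u \<le> m + n"
    by (simp add: degree_le_def monom_degree_add add_mono)
qed

lemma degree_le_power: "degree_le 1 p \<Longrightarrow> degree_le n (p ^ n)"
proof (induction n)
  case (Suc n)
  then show ?case
    using degree_le_mult[of 1 p n "p ^ n"] by simp
qed (simp add: degree_le_one)

lemma degree_le_monom_value:
  assumes "\<And>x. degree_le 1 (f x)"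
  shows "degree_le (monom_degree v) (monom_value f v)"
proof -
  have "degree_le (\<Sum>x\<in>K. n x) (\<Prod>x\<in>K. f x ^ n x)" for K n
    by (induction K rule: infinite_finite_induct)
      (auto intro!: degree_le_one degree_le_mult degree_le_power assms)
  then show ?thesis
    by (simp add: monom_degree_def monom_value_def)
qed

lemma keys_subst_poly:
  assumes "u \<in> Poly_Mapping.keys (subst_poly f p)"
  obtains v where "v \<in> Poly_Mapping.keys p" "u \<in> Poly_Mapping.keys (monom_value f v)"
proof -
  obtain v where v: "v \<in> Poly_Mapping.keys p"
    "u \<in> Poly_Mapping.keys (Const (Poly_Mapping.lookup p v) * monom_value f v)"
    using subsetD[OF keys_sum assms[unfolded insertion_def]] by blast
  then have "u \<in> Poly_Mapping.keys (monom_value f v)"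
    using keys_mult[of "Const (Poly_Mapping.lookup p v)" "monom_value f v"]
    by (auto simp: Const_def split: if_splits)
  with v(1) show thesis
    by (rule that)
qed

lemma degree_le_subst_poly:
  assumes "\<And>x. degree_le 1 (f x)"
  shows "degree_le (total_degree p) (subst_poly f p)"
  unfolding degree_le_def
proof
  fix u assume "u \<in> Poly_Mapping.keys (subst_poly f p)"
  then obtain v where v: "v \<in> Poly_Mapping.keys p" "u \<in> Poly_Mapping.keys (monom_value f v)"
    by (rule keys_subst_poly)
  then have "monom_degree u \<le> monom_degree v"
    using degree_le_monom_value[of f v, OF assms] by (simp add: degree_le_def)
  also have "\<dots> \<le> total_degree p"
    unfolding total_degree_def using v(1) by (intro Max_ge) auto
  finally show "monom_degree u \<le> total_degree p" .
qed

section \<open>The obstruction to decomposability\<close>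

text \<open>
  The squarefree monomials that cannot occur in the specialisation of a polynomial in
  \<open>O(4)\<close>-invariants of degree less than \<open>card N\<close>.
\<close>

definition obstruction :: "'v \<Rightarrow> 'v set \<Rightarrow> ('v \<Rightarrow>\<^sub>0 nat) \<Rightarrow> bool" where
  "obstruction r N u \<longleftrightarrow> (\<forall>x. Poly_Mapping.lookup u x \<le> 1) \<and> u \<noteq> 0 \<and>
     (r \<notin> Poly_Mapping.keys u \<or> N \<subseteq> Poly_Mapping.keys u)"

definition unobstructed :: "'v \<Rightarrow> 'v set \<Rightarrow> ('v, 'k::zero) mpoly \<Rightarrow> bool" where
  "unobstructed r N p \<longleftrightarrow> (\<forall>u\<in>Poly_Mapping.keys p. \<not> obstruction r N u)"

text \<open>
  Suppose that neither factor is \<open>1\<close>. As \<open>u + w\<close> is squarefree, \<open>r\<close> is missing from one of the factors, and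
  this factor is obstructed.
\<close>

lemma obstruction_add:
  assumes "obstruction r N (u + w)" and "r \<in> N"
  shows "obstruction r N u \<or> obstruction r N w"
proof -
  have le: "Poly_Mapping.lookup u x + Poly_Mapping.lookup w x \<le> 1" for x
    using assms by (auto simp: obstruction_def lookup_add)
  have keys: "Poly_Mapping.keys (u + w) = Poly_Mapping.keys u \<union> Poly_Mapping.keys w"
    by (auto simp: in_keys_iff lookup_add)
  have sq: "Poly_Mapping.lookup u x \<le> 1" "Poly_Mapping.lookup w x \<le> 1" for x
    using le[of x] by auto
  have r: "r \<notin> Poly_Mapping.keys u \<or> r \<notin> Poly_Mapping.keys w"
    using le[of r] by (auto simp: in_keys_iff)
  show ?thesis
  proof (cases "u = 0 \<or> w = 0")
    case True
    then show ?thesis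
      using assms(1) by auto
  next
    case False
    then show ?thesis
      using r sq by (auto simp: obstruction_def)
  qed
qed

lemma unobstructed_Const [simp]: "unobstructed r N (Const c)"
  by (simp add: unobstructed_def Const_def obstruction_def)

lemma unobstructed_sum:
  "(\<And>i. i \<in> I \<Longrightarrow> unobstructed r N (p i)) \<Longrightarrow> unobstructed r N (sum p I)"
  using keys_sum[of p I] unfolding unobstructed_def by blast

lemma unobstructed_mult:
  assumes "unobstructed r N p" "unobstructed r N q" "r \<in> N"
  shows "unobstructed r N (p * q)"
  unfolding unobstructed_def
proof
  fix u assume "u \<in> Poly_Mapping.keys (p * q)"
  with keys_mult[of p q] obtain v w
    where "u = v + w" "v \<in> Poly_Mapping.keys p" "w \<in> Poly_Mapping.keys q"
    by blast
  with assms show "\<not> obstruction r N u"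
    using obstruction_add[of r N v w] by (auto simp: unobstructed_def)
qed

lemma unobstructed_subst_poly:
  fixes P :: "('w, 'k::comm_semiring_1) mpoly"
  assumes "\<And>x. x \<in> poly_vars P \<Longrightarrow> unobstructed r N (f x)" "r \<in> N"
  shows "unobstructed r N (subst_poly f P)"
proof -
  have power: "unobstructed r N (p ^ n)" if "unobstructed r N p" for p :: "('a, 'k) mpoly" and n
    using that unobstructed_Const[of r N 1]
    by (induction n) (auto simp: unobstructed_mult assms(2))
  have prod: "unobstructed r N (prod p K)" if "\<And>x. x \<in> K \<Longrightarrow> unobstructed r N (p x)"
    for p :: "'w \<Rightarrow> ('a, 'k) mpoly" and K
    using that unobstructed_Const[of r N 1]
    by (induction K rule: infinite_finite_induct) (auto simp: unobstructed_mult assms(2))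
  show ?thesis
    unfolding insertion_def monom_value_def
    by (intro unobstructed_sum unobstructed_mult prod power unobstructed_Const assms)
      (auto simp: poly_vars_def)
qed

lemma lookup_kill_variable:
  fixes p :: "('v, 'k::comm_semiring_1) mpoly"
  assumes "r \<notin> Poly_Mapping.keys u"
  shows "Poly_Mapping.lookup (subst_poly (\<lambda>x. if x = r then 0 else Var x) p) u =
    Poly_Mapping.lookup p u"
proof -
  have "monom_value (\<lambda>x. if x = r then 0 else Var x) v =
      (if r \<in> Poly_Mapping.keys v then 0 else Poly_Mapping.single v (1 :: 'k))" for v
  proof (cases "r \<in> Poly_Mapping.keys v")
    case True
    then show ?thesis
      unfolding monom_value_def by (auto intro!: prod_zero bexI[of _ r] simp: in_keys_iff zero_power)
  next
    case False
    then have "monom_value (\<lambda>x. if x = r then 0 else Var x) v = monom_value Var v"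
      unfolding monom_value_def by (intro prod.cong) auto
    with False show ?thesis
      by (simp add: monom_value_Var)
  qed
  then have "Poly_Mapping.lookup
      (Const (Poly_Mapping.lookup p v) * monom_value (\<lambda>x. if x = r then 0 else Var x) v) u =
      (if v = u then Poly_Mapping.lookup p u else 0)" for v
    using assms by (auto simp: Const_def mult_single lookup_single when_def)
  then show ?thesis
    by (simp add: insertion_def lookup_sum in_keys_iff)
qed

text \<open>
  The specialisation of the vectors to \<open>E\<^sub>1\<^sub>2\<close> (index \<open>p\<close>), \<open>E\<^sub>2\<^sub>1\<close> (index \<open>q\<close>), \<open>t\<^sub>r E\<^sub>1\<^sub>1\<close>
  (index \<open>r\<close>), \<open>t\<^sub>i I\<close> (the other indices in \<open>N\<close>) and \<open>0\<close> (all other indices).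
\<close>

definition probe :: "nat \<Rightarrow> nat \<Rightarrow> nat \<Rightarrow> nat set \<Rightarrow> coord \<times> nat \<Rightarrow> (nat, 'k::field) mpoly" where
  "probe p q r N = (\<lambda>(c, i).
     if i = p then if c = X2 then 1 else 0
     else if i = q then if c = Y2 then 1 else 0
     else if i \<in> N \<and> (c = X1 \<or> c = Y1 \<and> i \<noteq> r) then Var i
     else 0)"

lemma degree_le_probe: "degree_le 1 (probe p q r N x)"
  by (cases x) (auto simp: probe_def degree_le_def monom_degree_def)

text \<open>
  A monomial divisible by all \<open>t\<^sub>i\<close> is too large for the degree of \<open>g\<close>. The monomials not
  containing \<open>t\<^sub>r\<close> survive the substitution \<open>t\<^sub>r = 0\<close>, after which the specialisation is
  symmetric under the reflection, so that they have even exponents.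
\<close>

lemma unobstructed_probe:
  fixes g :: "(coord \<times> nat, 'k::field) mpoly"
  assumes char2: "(2 :: 'k) = 0" and inv: "\<And>h. h \<in> O4 \<Longrightarrow> act h g = g"
    and N: "finite N" "total_degree g < card N"
  shows "unobstructed r N (subst_poly (probe p q r N) g)"
  unfolding unobstructed_def
proof (intro ballI notI)
  fix u
  assume u: "u \<in> Poly_Mapping.keys (subst_poly (probe p q r N) g)" and obs: "obstruction r N u"
  show False
  proof (cases "r \<in> Poly_Mapping.keys u")
    case True
    have "card N \<le> card (Poly_Mapping.keys u)"
      using obs True by (intro card_mono) (auto simp: obstruction_def)
    also have "\<dots> = (\<Sum>x\<in>Poly_Mapping.keys u. 1)"
      by simp
    also have "\<dots> \<le> monom_degree u"
      unfolding monom_degree_def by (intro sum_mono) (simp add: in_keys_iff Suc_le_eq)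
    also have "\<dots> \<le> total_degree g"
      using degree_le_subst_poly[of "probe p q r N" g, OF degree_le_probe] u by (auto simp: degree_le_def)
    finally show False
      using N by simp
  next
    case False
    let ?\<kappa> = "\<lambda>x. if x = r then 0 else Var x :: (nat, 'k) mpoly"
    let ?\<delta> = "\<lambda>x. subst_poly ?\<kappa> (probe p q r N x)"
    have one: "subst_poly ?\<kappa> 1 = 1"
      using subst_poly_Const[of ?\<kappa> 1] by (simp del: subst_poly_Const)
    have "even_poly (subst_poly ?\<delta> g)"
    proof (rule even_poly_subst_swap_invariant[OF char2 O4_invariant_swap[OF inv]])
      show "?\<delta> (Y1, i) = ?\<delta> (X1, i)" for i
        by (simp add: probe_def)
      show "even_poly (?\<delta> (X1, i) * ?\<delta> (X1, i))" for i
        by (simp add: probe_def even_poly_Var_square)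
      show "even_poly (?\<delta> (X2, i))" "even_poly (?\<delta> (Y2, i))" for i
        by (simp_all add: probe_def one)
    qed
    moreover have "u \<in> Poly_Mapping.keys (subst_poly ?\<delta> g)"
      using u False
      by (simp add: in_keys_iff lookup_kill_variable flip: subst_poly_subst_poly)
    ultimately have even: "even (Poly_Mapping.lookup u x)" for x
      by (simp add: even_poly_def)
    have "Poly_Mapping.lookup u x = 0" for x
      using even[of x] obs by (cases "Poly_Mapping.lookup u x = 1") (auto simp: obstruction_def le_Suc_eq)
    then have "u = 0"
      by (intro poly_mapping_eqI) simp
    with obs show False
      by (simp add: obstruction_def)
  qed
qed

lemma prod_list_scalar_pairs:
  assumes "length il = length jl" "\<And>i. i \<in> set (il @ jl) \<Longrightarrow> A i = scal2 (t i)"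
  shows "prod_list (map2 (\<lambda>a b. adj2 a * b) (map A il) (map A jl)) =
    scal2 (prod_list (map t (il @ jl)))"
  using assms
proof (induction il jl rule: list_induct2)
  case (Cons i il j jl)
  then show ?case
    by (simp add: mult_ac flip: scal2_mult)
qed simp

text \<open>
  The product of matrices starts with \<open>adj E\<^sub>1\<^sub>2 E\<^sub>2\<^sub>1 = - E\<^sub>1\<^sub>1\<close> for \<open>T\<close>, and with
  \<open>E\<^sub>1\<^sub>2 adj E\<^sub>2\<^sub>1 = - E\<^sub>1\<^sub>1\<close> for \<open>T'\<close>. The factor for \<open>r\<close> is a multiple of \<open>adj E\<^sub>1\<^sub>1 = E\<^sub>2\<^sub>2\<close>
  in \<open>T\<close>, which is killed, and of \<open>E\<^sub>1\<^sub>1\<close> in \<open>T'\<close>; all other factors are scalar.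
\<close>

lemma probe_trace_inv:
  assumes len: "length il = length jl" and dist: "distinct ((p # r # il) @ (q # j # jl))"
    and N: "N = set ((r # il) @ (j # jl))"
  shows "subst_poly (probe p q r N) (trace_inv (p # r # il) (q # j # jl) +
      trace_inv' (p # r # il) (q # j # jl)) =
    - (\<Prod>i\<in>N. Var i :: (nat, 'k::field) mpoly)"
proof -
  let ?\<delta> = "probe p q r N :: coord \<times> nat \<Rightarrow> (nat, 'k) mpoly"
  interpret \<delta>: comm_ring_hom "subst_poly ?\<delta>"
    by (rule comm_ring_hom_subst_poly)
  let ?V = "\<lambda>i. map_mat2 (subst_poly ?\<delta>) (vec_mat2 i)"
  have V: "?V i = Mat2 (?\<delta> (X1, i)) (?\<delta> (X2, i)) (?\<delta> (Y2, i)) (?\<delta> (Y1, i))" for i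
    by (simp add: vec_mat2_def)
  have Vp: "?V p = Mat2 0 1 0 0" and Vq: "?V q = Mat2 0 0 1 0" and Vr: "?V r = Mat2 (Var r) 0 0 0"
    using dist unfolding V by (auto simp: probe_def N)
  have Vj: "?V j = scal2 (Var j)" and Vl: "\<And>i. i \<in> set (il @ jl) \<Longrightarrow> ?V i = scal2 (Var i)"
    using dist unfolding V by (auto simp: probe_def N scal2_def)
  have tail: "prod_list (map2 (\<lambda>a b. adj2 a * b) (map ?V il) (map ?V jl)) =
      scal2 (prod_list (map Var (il @ jl)))"
    by (rule prod_list_scalar_pairs[OF len Vl])
  have tail': "prod_list (map2 (\<lambda>a b. adj2 a * b) (map (\<lambda>i. adj2 (?V i)) il)
      (map (\<lambda>i. adj2 (?V i)) jl)) = scal2 (prod_list (map Var (il @ jl)))"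
    using Vl by (intro prod_list_scalar_pairs[OF len]) simp
  have "subst_poly ?\<delta> (trace_inv (p # r # il) (q # j # jl)) = 0"
    unfolding trace_inv_def \<delta>.hom_cyclic_trace
    by (simp add: cyclic_trace_def Vp Vq Vr Vj comp_def tail)
      (simp add: scal2_def)
  moreover have "subst_poly ?\<delta> (trace_inv' (p # r # il) (q # j # jl)) =
      - (Var r * Var j * prod_list (map Var (il @ jl)))"
    unfolding trace_inv'_def \<delta>.hom_cyclic_trace
    by (simp add: cyclic_trace_def \<delta>.map_mat2_adj2 Vp Vq Vr Vj comp_def tail')
      (simp add: scal2_def)
  moreover have "(\<Prod>i\<in>N. Var i :: (nat, 'k) mpoly) =
      prod_list (map Var (r # j # (il @ jl)))"
    using dist by (subst prod.distinct_set_conv_list[symmetric]) (auto simp: N intro!: prod.cong)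
  ultimately show ?thesis
    by (simp add: \<delta>.hom_add mult.assoc)
qed

theorem proposition2p7:
  fixes \<sigma> :: "'k::alg_closed_field ^ coord ^ coord"
    and m s :: nat
    and il jl :: "nat list"
  assumes "CHAR('k) = 2"
    and "s \<ge> 2"
    and "length il = s" and "length jl = s"
    and "set (il @ jl) \<subseteq> {1..m}"
    and "distinct (il @ jl)"
    and "\<sigma> \<in> O4 - SO4"
  shows "G_poly \<sigma> il jl \<in> O4_invariants m \<and>
    \<not> expressible_in {f \<in> O4_invariants m. total_degree f < 2 * s - 2} (G_poly \<sigma> il jl)"
proof -
  have char2: "(2 :: 'k) = 0"
    using of_nat_CHAR[where 'a = 'k] assms(1) by simp
  have len: "length il = length jl"
    using assms by simp
  have F: "F_poly il jl = (trace_inv il jl :: (coord \<times> nat, 'k) mpoly)"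
    unfolding trace_inv_def using assms by (intro F_poly_eq_cyclic_trace char2) auto
  have "act \<sigma> (trace_inv il jl) = trace_inv' il jl"
    using act_trace_inv[OF char2 _ len, of \<sigma>] assms(7) by auto
  then have G: "G_poly \<sigma> il jl = trace_inv il jl + trace_inv' il jl"
    by (simp add: G_poly_def F)
  have inv: "G_poly \<sigma> il jl \<in> O4_invariants m"
  proof -
    have "act g (trace_inv il jl + trace_inv' il jl) = trace_inv il jl + trace_inv' il jl"
      if "g \<in> O4" for g :: "'k ^ coord ^ coord"
    proof -
      interpret act: comm_ring_hom "act g"
        by (rule comm_ring_hom_act)
      show ?thesis
        using act_trace_inv[OF char2 that len] by (auto simp: act.hom_add add.commute)
    qed
    then show ?thesis
      unfolding G O4_invariants_def
      using R4_add[OF R4_trace_inv[OF assms(5) len]] by simp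
  qed
  have "\<not> expressible_in {f \<in> O4_invariants m. total_degree f < 2 * s - 2} (G_poly \<sigma> il jl)"
  proof
    assume "expressible_in {f \<in> O4_invariants m. total_degree f < 2 * s - 2} (G_poly \<sigma> il jl)"
    then obtain P :: "(nat, 'k) mpoly" and f where
      f: "\<And>n. n \<in> poly_vars P \<Longrightarrow> f n \<in> O4_invariants m \<and> total_degree (f n) < 2 * s - 2"
      and P: "G_poly \<sigma> il jl = subst_poly f P"
      unfolding expressible_in_def by blast
    obtain p r il' where il: "il = p # r # il'"
      using assms(2,3) by (cases il; cases "tl il") auto
    obtain q j jl' where jl: "jl = q # j # jl'"
      using assms(2,4) by (cases jl; cases "tl jl") auto
    define N where "N = set ((r # il') @ (j # jl'))"
    have card: "card N = 2 * s - 2"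
      using assms(3,4,6) unfolding N_def by (subst distinct_card) (auto simp: il jl)
    have rN: "r \<in> N" "finite N"
      by (simp_all add: N_def)
    let ?D = "subst_poly (probe p q r N) :: (coord \<times> nat, 'k) mpoly \<Rightarrow> (nat, 'k) mpoly"
    have D_f: "unobstructed r N (?D (f n))" if "n \<in> poly_vars P" for n
      using f[OF that] card rN(2) by (intro unobstructed_probe char2) (auto simp: O4_invariants_def)
    have "unobstructed r N (?D (G_poly \<sigma> il jl))"
      unfolding P subst_poly_subst_poly by (rule unobstructed_subst_poly[OF D_f rN(1)])
    moreover have "?D (G_poly \<sigma> il jl) = - (\<Prod>i\<in>N. Var i)"
      unfolding G unfolding il jl using assms(3,4,6) by (intro probe_trace_inv N_def) (auto simp: il jl)
    moreover have "(\<Prod>i\<in>N. Var i :: (nat, 'k) mpoly) =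
        Poly_Mapping.single (\<Sum>i\<in>N. Poly_Mapping.single i 1) 1"
      by (simp add: Var_def prod_single)
    ultimately have "\<not> obstruction r N (\<Sum>i\<in>N. Poly_Mapping.single i 1)"
      by (simp add: unobstructed_def)
    moreover have "Poly_Mapping.lookup (\<Sum>i\<in>N. Poly_Mapping.single i 1) x =
        (if x \<in> N then 1 else 0 :: nat)" for x
      using rN(2) by (simp add: lookup_sum lookup_single when_def)
    then have "obstruction r N (\<Sum>i\<in>N. Poly_Mapping.single i 1)"
      using rN(1) by (auto simp: obstruction_def in_keys_iff dest: arg_cong[of _ _ "\<lambda>u. Poly_Mapping.lookup u r"])
    ultimately show False
      by blast
  qed
  with inv show ?thesis
    by blast
qed

end
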